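(* Let $\psi:\mathbb{N}\to\mathbb{N}$ satisfy $\psi(n)/n\to\infty$ as $n\to\infty$. Define $b$ and $B$ by $$\liminf_{n\to\infty}\frac{\log\psi(n)}{n}=\log b,\qquad \limsup_{n\to\infty}\frac{\log\psi(n)}{n}=\log B,$$ and assume $b,B\in(1,\infty]$. Let $$\overline{E}(\psi)=\left\{x\in[0,1]:\ \limsup_{n\to\infty}\frac{\log a_1(x)+\cdots+\log a_n(x)}{\psi(n)}=1\right\},$$ $$\underline{E}(\psi)=\left\{x\in[0,1]:\ \liminf_{n\to\infty}\frac{\log a_1(x)+\cdots+\log a_n(x)}{\psi(n)}=1\right\}.$$ Then $$\dim_H\overline{E}(\psi)=\frac{1}{1+b}\quad\text{and}\quad \dim_H\underline{E}(\psi)=\frac{1}{1+B}.$$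
   Context: $\mathbb{N}$ is the set of positive integers and $\dim_H$ denotes Hausdorff dimension. For an irrational $x\in(0,1)$, $a_1(x),a_2(x),\dots$ are the partial quotients of its (infinite, regular) continued fraction expansion $x=[a_1(x),a_2(x),\dots]=1/(a_1(x)+1/(a_2(x)+\cdots))$, i.e. $a_1(x)=\lfloor 1/x\rfloor$ and $a_n(x)=a_1(T^{n-1}x)$ where $T$ is the Gauss map $T(x)=1/x \pmod 1$ for $x\in(0,1)$, $T(0)=0$. The sets in the claim are understood to consist of irrational $x$ (those with infinite expansions). Convention: $1/(1+\infty)=0$. *)

theory Defs
  imports "HOL-Analysis.Analysis"
begin

section \<open>Hausdorff dimension\<close>

(* diam(U)^s, with the usual conventions diam({})^s = 0 and diam(U)^0 = 1 for nonempty U;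
   the case s = 0 is separate because 0 powr 0 = 0 in HOL. *)
definition diam_powr :: "real \<Rightarrow> 'a::metric_space set \<Rightarrow> ennreal" where
  "diam_powr s U =
     (if U = {} then 0 else if s = 0 then 1 else ennreal (diameter U powr s))"

(* Boundedness is required because diameter has no meaningful value on unbounded sets.
   Finite covers are included, by padding with empty sets. *)
definition hausdorff_premeasure :: "real \<Rightarrow> real \<Rightarrow> 'a::metric_space set \<Rightarrow> ennreal" where
  "hausdorff_premeasure \<delta> s A =
     (INF U \<in> {U :: nat \<Rightarrow> 'a set.
                 A \<subseteq> (\<Union>i. U i) \<and> (\<forall>i. bounded (U i) \<and> diameter (U i) \<le> \<delta>)}.
        \<Sum>i. diam_powr s (U i))"

definition hausdorff_measure :: "real \<Rightarrow> 'a::metric_space set \<Rightarrow> ennreal" where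
  "hausdorff_measure s A = (SUP \<delta> \<in> {0<..}. hausdorff_premeasure \<delta> s A)"

definition hausdorff_dim :: "'a::metric_space set \<Rightarrow> ennreal" where
  "hausdorff_dim A = (INF s \<in> {s. 0 \<le> s \<and> hausdorff_measure s A = 0}. ennreal s)"

section \<open>Continued fractions\<close>

definition gauss_map :: "real \<Rightarrow> real" where
  "gauss_map x = (if x = 0 then 0 else frac (1 / x))"

(* The index starts at 1; the value at n = 0 is meaningless and never used. *)
definition partial_quotient :: "nat \<Rightarrow> real \<Rightarrow> int" where
  "partial_quotient n x = \<lfloor>1 / (gauss_map ^^ (n - 1)) x\<rfloor>"

definition log_pq_sum :: "nat \<Rightarrow> real \<Rightarrow> real" where
  "log_pq_sum n x = (\<Sum>k = 1..n. ln (real_of_int (partial_quotient k x)))"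

definition E_upper :: "(nat \<Rightarrow> nat) \<Rightarrow> real set" where
  "E_upper \<psi> = {x \<in> {0..1}. x \<notin> \<rat> \<and>
     limsup (\<lambda>n. ereal (log_pq_sum n x / real (\<psi> n))) = 1}"

definition E_lower :: "(nat \<Rightarrow> nat) \<Rightarrow> real set" where
  "E_lower \<psi> = {x \<in> {0..1}. x \<notin> \<rat> \<and>
     liminf (\<lambda>n. ereal (log_pq_sum n x / real (\<psi> n))) = 1}"

section \<open>Extended logarithm\<close>

definition ext_ln :: "ennreal \<Rightarrow> ereal" where
  "ext_ln x = (if x = 0 then -\<infinity> else if x = \<infinity> then \<infinity> else ereal (ln (enn2real x)))"

end

theory Submission
  imports Defs "HOL-Probability.Infinite_Product_Measure" "HOL-Real_Asymp.Real_Asymp"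
begin

text \<open>
  Write \<open>S n\<close> for \<open>log_pq_sum n x\<close>.  If \<open>x\<close> and \<open>y\<close> share their first \<open>n\<close> partial quotients, then
  \<open>\<bar>x - y\<bar>\<close> is the product of the first \<open>n\<close> iterates of both points times the distance of the
  \<open>n\<close>-th iterates, so no convergents are needed.

  Upper bounds: if \<open>S n / c ^ n\<close> is unbounded, then at its records \<open>S (n + 1) \<ge> c * S n\<close> and
  \<open>S (n + 1) \<ge> c ^ (n + 1)\<close>, and the points with a given prefix \<open>w\<close> and such a record lie in a set of
  diameter at most \<open>exp (- S n - max (c * S n) (c ^ (n + 1)))\<close>.  For \<open>t * (1 + c) > 1\<close>,
  interpolating between the two arguments of the maximum bounds the \<open>t\<close>-th powers of these diameters
  by the terms of \<open>\<zeta>(p) ^ n * exp (- \<kappa> * c ^ (n + 1))\<close> for some \<open>p > 1\<close>, which is summable.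

  Lower bounds: given a nondecreasing \<open>s\<close> with \<open>s n / n \<rightarrow> \<infinity>\<close> and \<open>s (n + 1) \<le> \<beta> * s n\<close>, choose the
  \<open>n\<close>-th partial quotient uniformly and independently in a dyadic block of size about
  \<open>exp (s (n + 1) - s n)\<close>.  Then \<open>S n / s n \<rightarrow> 1\<close>, and the mass distribution principle gives dimension
  at least \<open>1 / (1 + \<beta>)\<close>.  For \<open>\<beta>\<close> slightly larger than \<open>b\<close> (respectively \<open>B\<close>), \<open>s\<close> is taken as the
  largest such sequence below \<open>\<psi>\<close> (respectively the smallest one above it); it meets \<open>\<psi>\<close>
  infinitely often.
\<close>

section \<open>Orbits of the Gauss map and the distance between points with a common prefix of
  quotients\<close>

section \<open>Iterates of the Gauss map\<close>

lemma gauss_map_irrational: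
  assumes "x \<notin> \<rat>"
  shows "gauss_map x \<notin> \<rat>" "0 < gauss_map x" "gauss_map x < 1"
proof -
  have x0: "x \<noteq> 0" using assms by auto
  have g: "gauss_map x = 1 / x - of_int \<lfloor>1 / x\<rfloor>" using x0 by (simp add: gauss_map_def frac_def)
  show irr: "gauss_map x \<notin> \<rat>"
  proof
    assume "gauss_map x \<in> \<rat>"
    then have "gauss_map x + of_int \<lfloor>1 / x\<rfloor> \<in> \<rat>" by (intro Rats_add) auto
    then have "inverse (1 / x) \<in> \<rat>" unfolding g by (simp del: inverse_divide)
    then show False using assms by simp
  qed
  have "gauss_map x \<noteq> 0" using irr by auto
  moreover have "gauss_map x \<ge> 0" using x0 by (simp add: gauss_map_def)
  ultimately show "0 < gauss_map x" by simp
  show "gauss_map x < 1" using x0 by (simp add: gauss_map_def frac_lt_1)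
qed

lemma gauss_iterate_irrational:
  assumes "x \<in> {0..1}" "x \<notin> \<rat>"
  shows "(gauss_map ^^ n) x \<notin> \<rat>" "0 < (gauss_map ^^ n) x" "(gauss_map ^^ n) x < 1"
proof -
  have "x \<noteq> 0" "x \<noteq> 1" using assms(2) by auto
  then have *: "0 < x" "x < 1" using assms(1) by auto
  have "(gauss_map ^^ n) x \<notin> \<rat> \<and> 0 < (gauss_map ^^ n) x \<and> (gauss_map ^^ n) x < 1"
    by (induction n) (use assms * gauss_map_irrational in auto)
  then show "(gauss_map ^^ n) x \<notin> \<rat>" "0 < (gauss_map ^^ n) x" "(gauss_map ^^ n) x < 1"
    by auto
qed

lemma gauss_iterate_inverse:
  assumes "x \<in> {0..1}" "x \<notin> \<rat>"
  shows "1 / (gauss_map ^^ n) x = of_int (partial_quotient (Suc n) x) + (gauss_map ^^ Suc n) x"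
  using gauss_iterate_irrational[OF assms, of n]
  by (simp add: partial_quotient_def gauss_map_def frac_def)

lemma partial_quotient_pos:
  assumes "x \<in> {0..1}" "x \<notin> \<rat>"
  shows "partial_quotient (Suc n) x \<ge> 1"
  using gauss_iterate_irrational[OF assms, of n]
  by (simp add: partial_quotient_def field_simps le_floor_iff)

lemma gauss_iterate_bounds:
  assumes "x \<in> {0..1}" "x \<notin> \<rat>"
  shows "(gauss_map ^^ n) x \<le> 1 / of_int (partial_quotient (Suc n) x)"
    "1 / (of_int (partial_quotient (Suc n) x) + 1) \<le> (gauss_map ^^ n) x"
proof -
  define a where "a = real_of_int (partial_quotient (Suc n) x)"
  define y where "y = (gauss_map ^^ n) x"
  define z where "z = (gauss_map ^^ Suc n) x"
  have a: "a \<ge> 1" using partial_quotient_pos[OF assms, of n] unfolding a_def by linarith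
  have y: "y > 0" unfolding y_def by (rule gauss_iterate_irrational(2)[OF assms])
  have z: "0 < z" "z < 1" unfolding z_def
    by (rule gauss_iterate_irrational(2)[OF assms], rule gauss_iterate_irrational(3)[OF assms])
  have "1 / y = a + z" using gauss_iterate_inverse[OF assms, of n] by (simp add: a_def y_def z_def)
  then have "y = 1 / (a + z)" using y a z by (simp add: field_simps)
  moreover have "1 / (a + z) \<le> 1 / a" "1 / (a + 1) \<le> 1 / (a + z)"
    using a z by (intro divide_left_mono; simp)+
  ultimately show "(gauss_map ^^ n) x \<le> 1 / of_int (partial_quotient (Suc n) x)"
    "1 / (of_int (partial_quotient (Suc n) x) + 1) \<le> (gauss_map ^^ n) x"
    by (simp_all add: a_def y_def)
qed

text \<open>Inversion gives |u - v| = u v |1/u - 1/v|, and 1/u is a partial quotient plus the next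
  iterate. The quotients stay in the formula: equal ones cancel along a common prefix, and different
  ones separate the points at the first disagreement.\<close>

lemma gauss_iterate_diff:
  assumes x: "x \<in> {0..1}" "x \<notin> \<rat>" and y: "y \<in> {0..1}" "y \<notin> \<rat>"
  shows "\<bar>(gauss_map ^^ n) x - (gauss_map ^^ n) y\<bar> =
    (gauss_map ^^ n) x * (gauss_map ^^ n) y *
    \<bar>of_int (partial_quotient (Suc n) x) + (gauss_map ^^ Suc n) x
      - (of_int (partial_quotient (Suc n) y) + (gauss_map ^^ Suc n) y)\<bar>"
proof -
  define u v where "u = (gauss_map ^^ n) x" and "v = (gauss_map ^^ n) y"
  have uv: "u > 0" "v > 0"
    using gauss_iterate_irrational(2)[OF x, of n] gauss_iterate_irrational(2)[OF y, of n]
    by (simp_all add: u_def v_def)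
  have "\<bar>u - v\<bar> = u * v * \<bar>1 / u - 1 / v\<bar>"
  proof -
    have "u * v * \<bar>1 / u - 1 / v\<bar> = \<bar>u * v * (1 / u - 1 / v)\<bar>"
      using uv by (simp add: abs_mult)
    also have "u * v * (1 / u - 1 / v) = v - u" using uv by (simp add: field_simps)
    finally show ?thesis by simp
  qed
  then show ?thesis
    unfolding gauss_iterate_inverse[OF x, symmetric] gauss_iterate_inverse[OF y, symmetric]
    by (simp add: u_def v_def)
qed

text \<open>Iterates \<open>gauss_iterate_diff\<close>, the equal quotients cancelling at each step.
  Being an exact identity, it serves both the diameter bound from above and the separation bound
  from below.\<close>

lemma dist_same_quotients:
  assumes x: "x \<in> {0..1}" "x \<notin> \<rat>" and y: "y \<in> {0..1}" "y \<notin> \<rat>"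
    and eq: "\<And>k. k < n \<Longrightarrow> partial_quotient (Suc k) x = partial_quotient (Suc k) y"
  shows "\<bar>x - y\<bar> = (\<Prod>k<n. (gauss_map ^^ k) x * (gauss_map ^^ k) y) *
    \<bar>(gauss_map ^^ n) x - (gauss_map ^^ n) y\<bar>"
  using eq
proof (induction n)
  case (Suc n)
  then show ?case
    using gauss_iterate_diff[OF x y, of n] Suc.prems[of n] by (simp add: mult.assoc)
qed simp

lemma log_pq_sum_0 [simp]: "log_pq_sum 0 x = 0"
  by (simp add: log_pq_sum_def)

lemma log_pq_sum_Suc:
  "log_pq_sum (Suc n) x = log_pq_sum n x + ln (of_int (partial_quotient (Suc n) x))"
  by (simp add: log_pq_sum_def)

lemma log_pq_sum_eq: "log_pq_sum n x = (\<Sum>k<n. ln (of_int (partial_quotient (Suc k) x)))"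
  by (induction n) (simp_all add: log_pq_sum_Suc)

lemma log_pq_sum_mono:
  assumes "x \<in> {0..1}" "x \<notin> \<rat>"
  shows "mono (\<lambda>n. log_pq_sum n x)"
proof (rule incseq_SucI, goal_cases)
  case (1 n)
  have "real_of_int (partial_quotient (Suc n) x) \<ge> 1"
    using partial_quotient_pos[OF assms, of n] by linarith
  then show ?case by (simp add: log_pq_sum_Suc)
qed

lemma log_pq_sum_nonneg:
  assumes "x \<in> {0..1}" "x \<notin> \<rat>"
  shows "0 \<le> log_pq_sum n x"
  using monoD[OF log_pq_sum_mono[OF assms], of 0 n] by simp

section \<open>Criteria for zero and for nonzero Hausdorff measure\<close>

section \<open>Hausdorff measure\<close>

lemma hausdorff_premeasure_mono:
  assumes "A \<subseteq> B"
  shows "hausdorff_premeasure \<delta> s A \<le> hausdorff_premeasure \<delta> s B"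
  unfolding hausdorff_premeasure_def
  by (rule INF_superset_mono) (use assms in auto)

lemma hausdorff_measure_mono:
  assumes "A \<subseteq> B"
  shows "hausdorff_measure s A \<le> hausdorff_measure s B"
  unfolding hausdorff_measure_def
  by (rule SUP_mono') (rule hausdorff_premeasure_mono[OF assms])

lemma hausdorff_measure_eq_0I:
  assumes "\<And>\<delta> \<epsilon>. \<delta> > 0 \<Longrightarrow> \<epsilon> > (0::real) \<Longrightarrow> \<exists>U :: nat \<Rightarrow> 'a::metric_space set. A \<subseteq> (\<Union>i. U i) \<and>
    (\<forall>i. bounded (U i) \<and> diameter (U i) \<le> \<delta>) \<and> (\<Sum>i. diam_powr s (U i)) \<le> ennreal \<epsilon>"
  shows "hausdorff_measure s A = 0"
proof -
  have "hausdorff_premeasure \<delta> s A = 0" if "\<delta> > 0" for \<delta>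
  proof -
    have "hausdorff_premeasure \<delta> s A \<le> 0"
    proof (rule ennreal_le_epsilon)
      fix \<epsilon> :: real assume "0 < \<epsilon>"
      from assms[OF \<open>\<delta> > 0\<close> this] obtain U where U: "A \<subseteq> (\<Union>i. U i)"
        "\<forall>i. bounded (U i) \<and> diameter (U i) \<le> \<delta>" "(\<Sum>i. diam_powr s (U i)) \<le> ennreal \<epsilon>" by blast
      have "hausdorff_premeasure \<delta> s A \<le> (\<Sum>i. diam_powr s (U i))"
        unfolding hausdorff_premeasure_def using U by (intro INF_lower) auto
      with U(3) show "hausdorff_premeasure \<delta> s A \<le> 0 + ennreal \<epsilon>" by simp
    qed
    then show ?thesis by simp
  qed
  then show ?thesis unfolding hausdorff_measure_def by (simp add: SUP_eq_const)
qed

text \<open>The last step of the mass distribution principle. An estimate valid for all bounded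
  covers, whatever their mesh, bounds the premeasure at scale 1 below by \<open>1 / C\<close>, and
  the measure is a supremum over scales.\<close>

lemma hausdorff_measure_neq_0I:
  assumes "C > (0::real)"
    and "\<And>U :: nat \<Rightarrow> 'a::metric_space set. A \<subseteq> (\<Union>i. U i) \<Longrightarrow> (\<And>i. bounded (U i)) \<Longrightarrow>
      1 \<le> (\<Sum>i. ennreal C * diam_powr s (U i))"
  shows "hausdorff_measure s A \<noteq> 0"
proof -
  have "ennreal (1 / C) \<le> hausdorff_premeasure 1 s A"
    unfolding hausdorff_premeasure_def
  proof (rule INF_greatest)
    fix U :: "nat \<Rightarrow> 'a set"
    assume "U \<in> {U. A \<subseteq> (\<Union>i. U i) \<and> (\<forall>i. bounded (U i) \<and> diameter (U i) \<le> 1)}"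
    then have "1 \<le> (\<Sum>i. ennreal C * diam_powr s (U i))" using assms(2)[of U] by auto
    then have "1 \<le> ennreal C * (\<Sum>i. diam_powr s (U i))" by simp
    then have "ennreal (1 / C) * 1 \<le> ennreal (1 / C) * (ennreal C * (\<Sum>i. diam_powr s (U i)))"
      by (rule mult_left_mono) simp
    also have "\<dots> = (\<Sum>i. diam_powr s (U i))"
      using assms(1) by (simp add: mult.assoc[symmetric] ennreal_mult[symmetric])
    finally show "ennreal (1 / C) \<le> (\<Sum>i. diam_powr s (U i))" by simp
  qed
  also have "\<dots> \<le> hausdorff_measure s A"
    unfolding hausdorff_measure_def by (rule SUP_upper) simp
  finally show ?thesis using assms(1) by auto
qed

section \<open>Upper bounds: covers of the points of fast growth\<close>

section \<open>Points of fast growth\<close>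

lemma gauss_iterate_le_exp:
  assumes "x \<in> {0..1}" "x \<notin> \<rat>"
  shows "(gauss_map ^^ n) x \<le> exp (log_pq_sum n x - log_pq_sum (Suc n) x)"
proof -
  have "real_of_int (partial_quotient (Suc n) x) > 0"
    using partial_quotient_pos[OF assms, of n] by linarith
  then show ?thesis
    using gauss_iterate_bounds(1)[OF assms, of n] by (simp add: log_pq_sum_Suc exp_minus inverse_eq_divide)
qed

lemma prod_gauss_iterate_le:
  assumes "x \<in> {0..1}" "x \<notin> \<rat>"
  shows "(\<Prod>k<n. (gauss_map ^^ k) x) \<le> exp (- log_pq_sum n x)"
proof (induction n)
  case (Suc n)
  have "(\<Prod>k<Suc n. (gauss_map ^^ k) x)
      \<le> exp (- log_pq_sum n x) * exp (log_pq_sum n x - log_pq_sum (Suc n) x)"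
    unfolding prod.lessThan_Suc
    using Suc gauss_iterate_le_exp[OF assms, of n] gauss_iterate_irrational(2)[OF assms]
    by (intro mult_mono) (auto simp: less_imp_le)
  then show ?case by (simp add: exp_add[symmetric])
qed simp

text \<open>Let S be the common value of \<open>log_pq_sum n\<close> at both points. Each of the two
  products in \<open>dist_same_quotients\<close> is at most exp(-S), and both n-th iterates lie
  between 0 and exp(S - K); the exponents add up to -S - K.\<close>

lemma dist_same_quotients_le:
  assumes x: "x \<in> {0..1}" "x \<notin> \<rat>" and y: "y \<in> {0..1}" "y \<notin> \<rat>"
    and eq: "\<And>k. k < n \<Longrightarrow> partial_quotient (Suc k) x = partial_quotient (Suc k) y"
    and K: "log_pq_sum (Suc n) x \<ge> K" "log_pq_sum (Suc n) y \<ge> K"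
  shows "\<bar>x - y\<bar> \<le> exp (- log_pq_sum n x - K)"
proof -
  have L: "log_pq_sum n y = log_pq_sum n x"
    using eq by (simp add: log_pq_sum_eq)
  have pos: "(\<Prod>k<n. (gauss_map ^^ k) x) \<ge> 0" "(\<Prod>k<n. (gauss_map ^^ k) y) \<ge> 0"
    using gauss_iterate_irrational(2)[OF x] gauss_iterate_irrational(2)[OF y]
    by (auto intro!: prod_nonneg simp: less_imp_le)
  have "(gauss_map ^^ n) x \<le> exp (log_pq_sum n x - K)"
    using gauss_iterate_le_exp[OF x, of n] K(1) by (rule_tac order_trans) auto
  moreover have "(gauss_map ^^ n) y \<le> exp (log_pq_sum n x - K)"
    using gauss_iterate_le_exp[OF y, of n] K(2) L by (rule_tac order_trans) auto
  ultimately have d: "\<bar>(gauss_map ^^ n) x - (gauss_map ^^ n) y\<bar> \<le> exp (log_pq_sum n x - K)"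
    using gauss_iterate_irrational(2)[OF x, of n] gauss_iterate_irrational(2)[OF y, of n] by linarith
  have "\<bar>x - y\<bar> = (\<Prod>k<n. (gauss_map ^^ k) x) * (\<Prod>k<n. (gauss_map ^^ k) y) *
      \<bar>(gauss_map ^^ n) x - (gauss_map ^^ n) y\<bar>"
    by (subst dist_same_quotients[OF x y eq]) (simp_all add: prod.distrib)
  also have "\<dots> \<le> exp (- log_pq_sum n x) * exp (- log_pq_sum n x) * exp (log_pq_sum n x - K)"
    using prod_gauss_iterate_le[OF x, of n] prod_gauss_iterate_le[OF y, of n] pos d L
    by (intro mult_mono) auto
  also have "\<dots> = exp (- log_pq_sum n x - K)" by (simp add: exp_add[symmetric])
  finally show ?thesis .
qed

text \<open>Splitting off the first letter factorises the sum over words. Writing sums as integrals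
  over \<open>count_space\<close> allows an infinite alphabet without summability
  conditions.\<close>

lemma nn_integral_words:
  fixes g :: "'a::countable \<Rightarrow> ennreal"
  shows "(\<integral>\<^sup>+w. prod_list (map g w) \<partial>count_space {w. length w = n}) =
    (\<integral>\<^sup>+a. g a \<partial>count_space UNIV) ^ n"
proof (induction n)
  case 0
  have "{w :: 'a list. length w = 0} = {[]}" by auto
  then show ?case by (simp add: nn_integral_count_space_finite)
next
  case (Suc n)
  let ?L = "{w :: 'a list. length w = n}"
  have "bij_betw (\<lambda>(a, w). a # w) (UNIV \<times> ?L) {w :: 'a list. length w = Suc n}"
    by (rule bij_betwI[where g = "\<lambda>w. (hd w, tl w)"]) (auto simp: length_Suc_conv)
  from nn_integral_bij_count_space[OF this, of "\<lambda>w. prod_list (map g w)"]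
  have "(\<integral>\<^sup>+w. prod_list (map g w) \<partial>count_space {w. length w = Suc n}) =
      (\<integral>\<^sup>+(a, w). g a * prod_list (map g w) \<partial>count_space (UNIV \<times> ?L))"
    by (simp add: case_prod_unfold)
  also have "\<dots> = (\<integral>\<^sup>+(a, w). g a * (prod_list (map g w) * indicator ?L w) \<partial>count_space UNIV)"
    by (subst nn_integral_count_space_indicator)
      (auto intro!: nn_integral_cong split: split_indicator simp: NO_MATCH_def)
  also have "\<dots> = (\<integral>\<^sup>+a. \<integral>\<^sup>+w. g a * (prod_list (map g w) * indicator ?L w) \<partial>count_space UNIV \<partial>count_space UNIV)"
    by (subst nn_integral_fst_count_space[symmetric]) simp
  also have "\<dots> = (\<integral>\<^sup>+a. g a * (\<integral>\<^sup>+a. g a \<partial>count_space UNIV) ^ n \<partial>count_space UNIV)"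
    by (simp add: nn_integral_cmult nn_integral_count_space_indicator[symmetric] NO_MATCH_def Suc)
  also have "\<dots> = (\<integral>\<^sup>+a. g a \<partial>count_space UNIV) ^ Suc n"
    by (simp add: nn_integral_multc)
  finally show ?case .
qed

text \<open>The value is the zeta function at p although the index starts at 0, because
  \<open>0 powr - p\<close> is 0.\<close>

lemma nn_integral_zeta:
  assumes "p > 1"
  shows "(\<integral>\<^sup>+a. ennreal (real a powr - p) \<partial>count_space UNIV) = ennreal (\<Sum>a. real a powr - p)"
proof -
  have "summable (\<lambda>a. real a powr - p)" using assms by (simp add: summable_real_powr_iff)
  then show ?thesis by (simp add: nn_integral_count_space_nat suminf_ennreal2)
qed

text \<open>Lets \<open>nn_integral_words\<close> sum a bound that depends on a word only through
  its sum of logarithms. The letter 0 has to be excluded, since it makes the product 0 while the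
  exponential is positive.\<close>

lemma prod_list_powr:
  assumes "\<And>a. a \<in> set w \<Longrightarrow> a > (0::nat)"
  shows "prod_list (map (\<lambda>a. ennreal (real a powr - p)) w) = ennreal (exp (- p * (\<Sum>a\<leftarrow>w. ln (real a))))"
  using assms
  by (induction w) (auto simp: powr_def ennreal_mult[symmetric] exp_add[symmetric] algebra_simps)

text \<open>If every step from m on failed, then \<open>M\<close> could never exceed the maximum of
  1 and its first values, so it would be bounded. For \<open>M n = log_pq_sum n x / c ^ n\<close>
  the two conclusions give both lower bounds on \<open>log_pq_sum (Suc n) x\<close> that enter the
  diameter estimate.\<close>

lemma frequently_record:
  fixes M :: "nat \<Rightarrow> real"
  assumes unb: "\<And>K. \<exists>n. M n > K"
  shows "\<exists>n\<ge>m. M (Suc n) \<ge> 1 \<and> M (Suc n) \<ge> M n"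
proof (rule ccontr)
  assume "\<not> ?thesis"
  then have *: "M (Suc n) < max 1 (M n)" if "n \<ge> m" for n using that by force
  define K where "K = max 1 (Max (M ` {..m}))"
  have K: "M n \<le> K" if "n \<le> m" for n
    using that by (auto simp: K_def le_max_iff_disj)
  have "M n \<le> K" if "n \<ge> m" for n
    using that
  proof (induction n rule: dec_induct)
    case (step n)
    then show ?case using *[of n] by (auto simp: K_def)
  qed (rule K, simp)
  then have "M n \<le> K" for n using K[of n] by (cases "n \<le> m") auto
  then show False using unb[of K] by (meson linorder_not_le)
qed

lemma tendsto_power_exp_power:
  fixes c k z :: real
  assumes "z > 1" "c > 1" "k > 0"
  shows "(\<lambda>n. z ^ n * exp (- (k * c ^ Suc n))) \<longlonglongrightarrow> 0"
  using assms by real_asymp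

text \<open>Records occur arbitrarily late, so the record sets of words of length at least
  \<open>n0\<close> cover the set for every \<open>n0\<close>. It remains to choose
  \<open>n0\<close> so large that these sets are small and their t-th powers have a small
  sum.\<close>

lemma hausdorff_measure_fast_growth:
  assumes c: "c > 1" and t: "t * (1 + c) > 1"
  shows "hausdorff_measure t {x \<in> {0..1}. x \<notin> \<rat> \<and> (\<forall>K. \<exists>n. log_pq_sum n x > K * c ^ n)} = 0"
    (is "hausdorff_measure t ?A = 0")
proof (rule hausdorff_measure_eq_0I)
  fix \<delta> \<epsilon> :: real assume \<delta>: "\<delta> > 0" and \<epsilon>: "\<epsilon> > 0"
  have t0: "t > 0" using c t by (smt (verit) zero_less_mult_pos2)
  \<comment> \<open>\<open>p\<close> is the midpoint of 1 and \<open>t * (1 + c)\<close>. The weight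
    \<theta> solves \<open>p = t + t * c * (1 - \<theta>)\<close>: interpolating with it leaves
    exactly the exponent \<open>p\<close> on the letters and \<kappa> on
    \<open>c ^ Suc n\<close>.\<close>
  define \<theta> where "\<theta> = (t * (1 + c) - 1) / (2 * t * c)"
  define p where "p = (t * (1 + c) + 1) / 2"
  define \<kappa> where "\<kappa> = t * \<theta>"
  have p: "p > 1" using t by (simp add: p_def)
  have tc: "c * t > t" using c t0 by simp
  have "t * (1 + c) - 1 < 2 * t * c" using tc by (simp only: algebra_simps)
  then have \<theta>: "\<theta> > 0" "\<theta> < 1"
    using t t0 c by (simp_all add: \<theta>_def divide_simps)
  have p\<theta>: "p = t + t * c * (1 - \<theta>)"
    using t0 c by (simp add: p_def \<theta>_def field_simps)
  have \<kappa>: "\<kappa> > 0" using t0 \<theta> by (simp add: \<kappa>_def)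
  define Z where "Z = (\<Sum>a. real a powr - p)"
  have sZ: "summable (\<lambda>a. real a powr - p)" using p by (simp add: summable_real_powr_iff)
  have Z: "Z \<ge> 1" unfolding Z_def using sum_le_suminf[OF sZ, of "{1}"] by simp
  \<comment> \<open>The extra factor 2 turns the bound for words of length n into a term of a
    geometric series with sum \<epsilon>.\<close>
  have "((\<lambda>n. (2 * Z) ^ n * exp (- (\<kappa> * c ^ Suc n))) \<longlongrightarrow> 0) at_top"
    using tendsto_power_exp_power[of "2 * Z" c \<kappa>] Z c \<kappa> by simp
  then have "\<forall>\<^sub>F n in sequentially. (2 * Z) ^ n * exp (- (\<kappa> * c ^ Suc n)) < \<epsilon> / 2"
    by (rule order_tendstoD(2)) (use \<epsilon> in simp)
  moreover have "((\<lambda>n. exp (- (c ^ Suc n))) \<longlongrightarrow> 0) at_top" using c by real_asymp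
  then have "\<forall>\<^sub>F n in sequentially. exp (- (c ^ Suc n)) < \<delta>"
    by (rule order_tendstoD(2)) (use \<delta> in simp)
  ultimately have "\<forall>\<^sub>F n in sequentially. (2 * Z) ^ n * exp (- (\<kappa> * c ^ Suc n)) < \<epsilon> / 2 \<and>
      exp (- (c ^ Suc n)) < \<delta>"
    by (rule eventually_conj)
  then obtain n0 where n0: "\<And>n. n \<ge> n0 \<Longrightarrow> (2 * Z) ^ n * exp (- (\<kappa> * c ^ Suc n)) < \<epsilon> / 2"
      "\<And>n. n \<ge> n0 \<Longrightarrow> exp (- (c ^ Suc n)) < \<delta>"
    unfolding eventually_sequentially by blast
  define V where "V w = {x \<in> {0..1}. x \<notin> \<rat> \<and>
      (\<forall>k<length w. partial_quotient (Suc k) x = int (w ! k)) \<and>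
      log_pq_sum (Suc (length w)) x \<ge> c * log_pq_sum (length w) x \<and>
      log_pq_sum (Suc (length w)) x \<ge> c ^ Suc (length w)}" for w
  define h where "h w = (if length w \<ge> n0 then ennreal (exp (- (\<kappa> * c ^ Suc (length w)))) *
      prod_list (map (\<lambda>a. ennreal (real a powr - p)) w) else 0)" for w :: "nat list"
  define W where "W w = (if length w \<ge> n0 then V w else {})" for w
  have V_bdd: "bounded (V w)" for w
    by (rule bounded_subset[of "{0..1}"]) (auto simp: V_def)
  have V_diam: "diameter (V w) \<le> exp (- L - max (c * L) (c ^ Suc (length w)))"
    and V_pos: "\<And>a. a \<in> set w \<Longrightarrow> a > 0"
    if L: "L = (\<Sum>a\<leftarrow>w. ln (real a))" and ne: "V w \<noteq> {}" for w L
  proof -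
    have LV: "log_pq_sum (length w) x = L" if "x \<in> V w" for x
    proof -
      have "log_pq_sum (length w) x = (\<Sum>k<length w. ln (real (w ! k)))"
        unfolding log_pq_sum_eq using that by (intro sum.cong) (auto simp: V_def)
      then show ?thesis unfolding L by (simp add: sum_list_sum_nth atLeast0LessThan)
    qed
    show "diameter (V w) \<le> exp (- L - max (c * L) (c ^ Suc (length w)))"
    proof (rule diameter_le)
      fix x y assume x: "x \<in> V w" and y: "y \<in> V w"
      have "\<bar>x - y\<bar> \<le> exp (- log_pq_sum (length w) x - max (c * L) (c ^ Suc (length w)))"
        using x y LV[OF x] LV[OF y]
        by (intro dist_same_quotients_le) (auto simp: V_def)
      then show "norm (x - y) \<le> exp (- L - max (c * L) (c ^ Suc (length w)))"
        by (simp add: LV[OF x])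
    qed simp
    from ne obtain x where x: "x \<in> V w" by blast
    show "a > 0" if a: "a \<in> set w" for a
    proof -
      from a obtain k where "k < length w" "a = w ! k" by (auto simp: in_set_conv_nth)
      then have "int a = partial_quotient (Suc k) x" using x by (simp add: V_def)
      then show ?thesis using x partial_quotient_pos[of x k] by (simp add: V_def)
    qed
  qed
  have V_le: "diam_powr t (W w) \<le> h w" for w
  proof (cases "length w \<ge> n0 \<and> V w \<noteq> {}")
    case True
    define n where "n = length w"
    define L where "L = (\<Sum>a\<leftarrow>w. ln (real a))"
    note d = V_diam[OF L_def] and pos = V_pos[OF L_def]
    \<comment> \<open>The maximum dominates the convex combination of its two arguments with weights
      1 - \<theta> and \<theta>.\<close>
    define m where "m = max (c * L) (c ^ Suc n)"
    have "(1 - \<theta>) * (c * L) + \<theta> * c ^ Suc n \<le> (1 - \<theta>) * m + \<theta> * m"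
      using \<theta> by (intro add_mono mult_left_mono) (auto simp: m_def)
    also have "\<dots> = m" by (simp add: algebra_simps)
    finally have m: "t * ((1 - \<theta>) * (c * L) + \<theta> * c ^ Suc n) \<le> t * m"
      using t0 by (intro mult_left_mono) auto
    have "diameter (V w) powr t \<le> exp (- L - m) powr t"
      using d True t0 by (intro powr_mono2 diameter_ge_0 V_bdd) (auto simp: m_def n_def)
    also have "\<dots> = exp (- (t * L) - t * m)" by (simp add: exp_powr_real algebra_simps)
    also have "\<dots> \<le> exp (- (\<kappa> * c ^ Suc n) + (- p * L))"
      using m by (simp add: p\<theta> \<kappa>_def algebra_simps)
    finally have "diameter (V w) powr t \<le> exp (- (\<kappa> * c ^ Suc n)) * exp (- p * L)"
      by (simp only: exp_add)
    then show ?thesis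
      using True t0 pos
      by (simp add: W_def diam_powr_def h_def prod_list_powr ennreal_mult[symmetric] n_def L_def)
  qed (auto simp: W_def diam_powr_def h_def)
  show "\<exists>U. ?A \<subseteq> (\<Union>i. U i) \<and> (\<forall>i. bounded (U i) \<and> diameter (U i) \<le> \<delta>) \<and>
      (\<Sum>i. diam_powr t (U i)) \<le> ennreal \<epsilon>"
  proof (intro exI conjI allI)
    \<comment> \<open>Covers are indexed by natural numbers, so the words are enumerated by
      \<open>list_decode\<close>.\<close>
    show "?A \<subseteq> (\<Union>i. W (list_decode i))"
    proof
      fix x assume x: "x \<in> ?A"
      then have x': "x \<in> {0..1}" "x \<notin> \<rat>" by auto
      define M where "M n = log_pq_sum n x / c ^ n" for n
      have "\<exists>n. M n > K" for K
      proof -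
        from x obtain n where "log_pq_sum n x > K * c ^ n" by blast
        then have "M n > K" using c by (simp add: M_def less_divide_eq)
        then show ?thesis ..
      qed
      from frequently_record[OF this, of n0] obtain n
        where n: "n \<ge> n0" "M (Suc n) \<ge> 1" "M (Suc n) \<ge> M n" by blast
      define w where "w = map (\<lambda>k. nat (partial_quotient (Suc k) x)) [0..<n]"
      have "log_pq_sum (Suc n) x \<ge> c ^ Suc n"
        using n(2) c by (simp add: M_def le_divide_eq)
      moreover have "log_pq_sum (Suc n) x \<ge> c * log_pq_sum n x"
        using n(3) c by (simp add: M_def divide_simps mult.commute)
      moreover have "int (nat (partial_quotient (Suc k) x)) = partial_quotient (Suc k) x" for k
        using partial_quotient_pos[OF x', of k] by simp
      ultimately have "x \<in> V w"
        using x' by (simp add: V_def w_def)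
      then have "x \<in> W (list_decode (list_encode w))"
        using n(1) by (simp add: W_def w_def)
      then show "x \<in> (\<Union>i. W (list_decode i))" by blast
    qed
    fix i
    show "bounded (W (list_decode i))"
      using V_bdd by (simp add: W_def)
    show "diameter (W (list_decode i)) \<le> \<delta>"
    proof (cases "W (list_decode i) = {}")
      case False
      define w where "w = list_decode i"
      define L where "L = (\<Sum>a\<leftarrow>w. ln (real a))"
      from False have w: "n0 \<le> length w" "V w \<noteq> {}" by (auto simp: W_def w_def split: if_splits)
      have "L \<ge> 0" unfolding L_def
        by (rule sum_list_nonneg) (use V_pos[OF L_def w(2)] in \<open>auto intro!: ln_ge_zero simp: Suc_le_eq\<close>)
      then have "exp (- L - max (c * L) (c ^ Suc (length w))) \<le> exp (- (c ^ Suc (length w)))"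
        unfolding exp_le_cancel_iff by linarith
      with V_diam[OF L_def w(2)] n0(2)[OF w(1)] have "diameter (V w) \<le> \<delta>" by linarith
      then show ?thesis using w(1) by (simp add: W_def w_def)
    qed (use \<delta> in simp)
  next
    have "(\<Sum>i. diam_powr t (W (list_decode i))) \<le> (\<Sum>i. h (list_decode i))"
      by (intro suminf_le V_le) auto
    also have "\<dots> = (\<integral>\<^sup>+w. h w \<partial>count_space UNIV)"
      using nn_integral_bij_count_space[OF bij_list_decode, of h]
      by (simp add: nn_integral_count_space_nat)
    \<comment> \<open>The words are sorted by length, because for each fixed length the sum is a
      power of \<open>Z\<close>.\<close>
    also have "\<dots> = (\<integral>\<^sup>+w. (\<Sum>n. h w * indicator {w. length w = n} w) \<partial>count_space UNIV)"
    proof (rule nn_integral_cong)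
      fix w
      have "(\<Sum>n. h w * indicator {w. length w = n} w) = (\<Sum>n\<in>{length w}. h w * indicator {w. length w = n} w)"
        by (rule suminf_finite) auto
      then show "h w = (\<Sum>n. h w * indicator {w. length w = n} w)" by simp
    qed
    also have "\<dots> = (\<Sum>n. \<integral>\<^sup>+w. h w \<partial>count_space {w. length w = n})"
      by (subst nn_integral_suminf) (simp_all add: nn_integral_count_space_indicator)
    also have "\<dots> \<le> (\<Sum>n. ennreal (\<epsilon> / 2 * (1 / 2) ^ n))"
    proof (intro suminf_le)
      fix n
      show "(\<integral>\<^sup>+w. h w \<partial>count_space {w. length w = n}) \<le> ennreal (\<epsilon> / 2 * (1 / 2) ^ n)"
      proof (cases "n \<ge> n0")
        case True
        have "(\<integral>\<^sup>+w. h w \<partial>count_space {w. length w = n}) =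
          (\<integral>\<^sup>+w. ennreal (exp (- (\<kappa> * c ^ Suc n))) *
             prod_list (map (\<lambda>a. ennreal (real a powr - p)) w) \<partial>count_space {w. length w = n})"
          using True by (intro nn_integral_cong) (auto simp: h_def)
        also have "\<dots> = ennreal (exp (- (\<kappa> * c ^ Suc n)) * Z ^ n)"
          using Z by (simp add: nn_integral_cmult nn_integral_words nn_integral_zeta[OF p] Z_def
              ennreal_mult ennreal_power)
        also have "\<dots> \<le> ennreal (\<epsilon> / 2 * (1 / 2) ^ n)"
          using n0(1)[OF True] by (intro ennreal_leI) (simp add: field_simps power_mult_distrib)
        finally show ?thesis .
      next
        case False
        then have "(\<integral>\<^sup>+w. h w \<partial>count_space {w. length w = n}) =
            (\<integral>\<^sup>+w. 0 \<partial>count_space {w :: nat list. length w = n})"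
          by (intro nn_integral_cong) (auto simp: h_def)
        then show ?thesis by simp
      qed
    qed auto
    also have "\<dots> = ennreal (\<Sum>n. \<epsilon> / 2 * (1 / 2) ^ n)"
      using \<epsilon> by (intro suminf_ennreal2 summable_mult) auto
    also have "(\<Sum>n. \<epsilon> / 2 * (1 / 2) ^ n) = \<epsilon>"
      by (subst suminf_mult) (auto simp: suminf_geometric)
    finally show "(\<Sum>i. diam_powr t (W (list_decode i))) \<le> ennreal \<epsilon>" .
  qed
qed

section \<open>Existence and separation of points with prescribed quotients\<close>

section \<open>Points with prescribed partial quotients\<close>

text \<open>On p/q the Gauss map is a step of the Euclidean algorithm, sending it to (q mod p)/p, so
  the numerators decrease to 0. Hence a point whose orbit never vanishes is irrational.\<close>

lemma gauss_iterate_rational: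
  assumes "p < q"
  shows "\<exists>n. (gauss_map ^^ n) (real p / real q) = 0"
  using assms
proof (induction p arbitrary: q rule: less_induct)
  case (less p)
  show ?case
  proof (cases "p = 0")
    case True
    then show ?thesis by (intro exI[of _ 0]) simp
  next
    case False
    have "real q = real p * real (q div p) + real (q mod p)"
      by (simp only: of_nat_mult[symmetric] of_nat_add[symmetric] mult_div_mod_eq)
    then have "real q / real p - real (q div p) = real (q mod p) / real p"
      using False by (simp add: field_simps)
    then have "gauss_map (real p / real q) = real (q mod p) / real p"
      using False less.prems by (simp add: gauss_map_def frac_def floor_divide_of_nat_eq)
    moreover obtain n where "(gauss_map ^^ n) (real (q mod p) / real p) = 0"
      using less.IH[of "q mod p" p] False by auto
    ultimately show ?thesis by (intro exI[of _ "Suc n"]) (simp add: funpow_Suc_right del: funpow.simps)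
  qed
qed

text \<open>The image of the closed unit interval under n inverse branches of the Gauss map. It is
  closed so that compactness applies, at the price of endpoints whose partial quotients may differ
  from \<open>a\<close>.\<close>

primrec cf_cylinder :: "nat \<Rightarrow> (nat \<Rightarrow> nat) \<Rightarrow> real set" where
  "cf_cylinder 0 a = {0..1}"
| "cf_cylinder (Suc n) a = (\<lambda>t. 1 / (real (a 0) + t)) ` cf_cylinder n (\<lambda>i. a (Suc i))"

lemma cf_cylinder_unit: "(\<And>i. a i \<ge> 1) \<Longrightarrow> cf_cylinder n a \<subseteq> {0..1}"
proof (induction n arbitrary: a)
  case (Suc n)
  have "1 / (real (a 0) + t) \<in> {0..1}" if "t \<in> cf_cylinder n (\<lambda>i. a (Suc i))" for t
  proof -
    have "t \<ge> 0" using that Suc.IH[of "\<lambda>i. a (Suc i)"] Suc.prems by auto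
    moreover have "real (a 0) \<ge> 1" using Suc.prems[of 0] by simp
    ultimately show ?thesis by (auto simp: divide_simps)
  qed
  then show ?case by auto
qed simp

lemma cf_cylinder_props:
  assumes "\<And>i. a i \<ge> 1"
  shows "compact (cf_cylinder n a)" "cf_cylinder n a \<noteq> {}" "cf_cylinder (Suc n) a \<subseteq> cf_cylinder n a"
proof -
  show "compact (cf_cylinder n a)" using assms
  proof (induction n arbitrary: a)
    case (Suc n)
    have "real (a 0) + t \<noteq> 0" if "t \<in> cf_cylinder n (\<lambda>i. a (Suc i))" for t
    proof -
      have "t \<ge> 0" using that cf_cylinder_unit[of "\<lambda>i. a (Suc i)" n] Suc.prems by auto
      moreover have "real (a 0) \<ge> 1" using Suc.prems[of 0] by simp
      ultimately show ?thesis by simp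
    qed
    then have "continuous_on (cf_cylinder n (\<lambda>i. a (Suc i))) (\<lambda>t. 1 / (real (a 0) + t))"
      by (intro continuous_intros) auto
    moreover have "compact (cf_cylinder n (\<lambda>i. a (Suc i)))"
      by (rule Suc.IH) (rule Suc.prems)
    ultimately show ?case unfolding cf_cylinder.simps by (rule compact_continuous_image)
  qed simp
  show "cf_cylinder n a \<noteq> {}"
    by (induction n arbitrary: a) simp_all
  show "cf_cylinder (Suc n) a \<subseteq> cf_cylinder n a" using assms
  proof (induction n arbitrary: a)
    case 0
    show ?case using cf_cylinder_unit[of a "Suc 0"] 0 by simp
  next
    case (Suc n)
    have "cf_cylinder (Suc n) (\<lambda>i. a (Suc i)) \<subseteq> cf_cylinder n (\<lambda>i. a (Suc i))"
      by (rule Suc.IH) (rule Suc.prems)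
    then show ?case unfolding cf_cylinder.simps(2)[of "Suc n"] cf_cylinder.simps(2)[of n a] by (rule image_mono)
  qed
qed

text \<open>The nested compact cylinders have a common point. Inverting it and subtracting
  \<open>a 0\<close> gives a common point of the cylinders of the shifted sequence, so the whole
  orbit is controlled.\<close>

lemma exists_partial_quotients:
  fixes a :: "nat \<Rightarrow> nat"
  assumes a: "\<And>i. a i \<ge> 1"
  shows "\<exists>x\<in>{0..1}. x \<notin> \<rat> \<and> (\<forall>k. partial_quotient (Suc k) x = int (a k))"
proof -
  define I where "I a = (\<Inter>n. cf_cylinder n a)" for a
  have inverse: "x > 0 \<and> x \<le> 1 \<and> 1 / x - real (b 0) \<in> I (\<lambda>i. b (Suc i))"
    if b: "\<And>i. b i \<ge> 1" and x: "x \<in> I b" for b x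
  proof -
    have *: "x > 0 \<and> x \<le> 1 \<and> 1 / x - real (b 0) \<in> cf_cylinder n (\<lambda>i. b (Suc i))" for n
    proof -
      from x have "x \<in> cf_cylinder (Suc n) b" unfolding I_def by blast
      then obtain t where t: "t \<in> cf_cylinder n (\<lambda>i. b (Suc i))" "x = 1 / (real (b 0) + t)" by auto
      have "t \<ge> 0" using cf_cylinder_unit[of "\<lambda>i. b (Suc i)" n] b t(1) by auto
      moreover have "real (b 0) \<ge> 1" using b[of 0] by simp
      ultimately have "real (b 0) + t \<ge> 1" by simp
      moreover have e: "1 / x - real (b 0) = t" using t by simp
      ultimately show ?thesis using t(1) unfolding e by (simp add: t(2))
    qed
    then show ?thesis unfolding I_def by blast
  qed
  have step: "x > 0 \<and> x < 1 \<and> \<lfloor>1 / x\<rfloor> = int (b 0) \<and> gauss_map x \<in> I (\<lambda>i. b (Suc i))"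
    if b: "\<And>i. b i \<ge> 1" and x: "x \<in> I b" for b x
  proof -
    \<comment> \<open>Two further inversions exclude the endpoints: z > 0 forces 1/y > 1, hence y <
      1, and only then is \<open>b 0\<close> the floor of 1/x and y the image of x.\<close>
    define y where "y = 1 / x - real (b 0)"
    define z where "z = 1 / y - real (b 1)"
    have x': "x > 0" "x \<le> 1" "y \<in> I (\<lambda>i. b (Suc i))"
      using inverse[OF b x] by (auto simp: y_def)
    have y: "y > 0" "y \<le> 1" "z \<in> I (\<lambda>i. b (Suc (Suc i)))"
      using inverse[OF b x'(3)] by (auto simp: z_def)
    have z: "z > 0"
      using inverse[OF b y(3)] by auto
    have b1: "real (b 0) \<ge> 1" "real (b 1) \<ge> 1" using b[of 0] b[of 1] by auto
    have "1 / y > 1" using z b1 unfolding z_def by linarith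
    then have y1: "y < 1" using y by (simp add: field_simps)
    have "1 / x > 1" using y b1 unfolding y_def by linarith
    then have x1: "x < 1" using x' by (simp add: field_simps)
    have fl: "\<lfloor>1 / x\<rfloor> = int (b 0)" using y y1 unfolding y_def by (intro floor_unique) auto
    then have "gauss_map x = y" using x' by (simp add: gauss_map_def frac_def y_def)
    with fl x' x1 show ?thesis by simp
  qed
  have "\<Inter>(range (\<lambda>n. cf_cylinder n a)) \<noteq> {}"
  proof (rule compact_nest)
    have "decseq (\<lambda>n. cf_cylinder n a)" using cf_cylinder_props(3)[of a, OF a] by (rule decseq_SucI)
    then show "cf_cylinder n a \<subseteq> cf_cylinder m a" if "m \<le> n" for m n using that by (rule decseqD)
  qed (use cf_cylinder_props(1,2)[of a, OF a] in auto)
  then obtain x where x: "x \<in> I a" unfolding I_def by auto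
  have iter: "(gauss_map ^^ n) x \<in> I (\<lambda>i. a (i + n))" for n
  proof (induction n)
    case (Suc n)
    then show ?case using step[of "\<lambda>i. a (i + n)" "(gauss_map ^^ n) x", OF a] by simp
  qed (use x in simp)
  have it: "(gauss_map ^^ n) x > 0" "(gauss_map ^^ n) x < 1" "\<lfloor>1 / (gauss_map ^^ n) x\<rfloor> = int (a n)" for n
    using step[of "\<lambda>i. a (i + n)" "(gauss_map ^^ n) x", OF a iter[of n]] by simp_all
  have x01: "0 < x" "x < 1" using it(1,2)[of 0] by auto
  have "x \<notin> \<rat>"
  proof
    assume "x \<in> \<rat>"
    then obtain p q :: nat where "q \<noteq> 0" "\<bar>x\<bar> = real p / real q" by (rule Rats_abs_nat_div_natE)
    then have q: "q \<noteq> 0" "x = real p / real q" using x01 by auto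
    then have "real p < real q" using x01 by (simp add: divide_less_eq)
    then have "p < q" by simp
    from gauss_iterate_rational[OF this] obtain n where "(gauss_map ^^ n) x = 0" using q by auto
    with it(1)[of n] show False by simp
  qed
  then show ?thesis using x01 it(3) by (intro bexI[of _ x]) (auto simp: partial_quotient_def)
qed

text \<open>The Cantor set that carries the mass. The index is shifted: \<open>N k\<close> governs
  the quotient number k + 1.\<close>

definition quotient_box :: "(nat \<Rightarrow> nat) \<Rightarrow> real set" where
  "quotient_box N = {x \<in> {0..1}. x \<notin> \<rat> \<and>
     (\<forall>k. int (N k) \<le> partial_quotient (Suc k) x \<and> partial_quotient (Suc k) x < 2 * int (N k))}"

text \<open>Each iterate is at least \<open>1 / (2 * N k)\<close>, so the n + 1 factors for both
  points contribute at least the inverse of \<open>4 ^ Suc n\<close> times the squared product. The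
  remaining factor 2 pays for the tails beyond the quotient number n + 1.\<close>

lemma quotient_box_separation:
  assumes N: "\<And>k. N k \<ge> 2" and x: "x \<in> quotient_box N" and y: "y \<in> quotient_box N"
    and eq: "\<And>k. k < n \<Longrightarrow> partial_quotient (Suc k) x = partial_quotient (Suc k) y"
  shows "\<bar>real_of_int (partial_quotient (Suc n) x) - real_of_int (partial_quotient (Suc n) y)\<bar>
    \<le> 2 * 4 ^ Suc n * (\<Prod>k\<le>n. real (N k))\<^sup>2 * \<bar>x - y\<bar>"
proof -
  have x': "x \<in> {0..1}" "x \<notin> \<rat>" and y': "y \<in> {0..1}" "y \<notin> \<rat>"
    using x y by (auto simp: quotient_box_def)
  define Q where "Q = (\<Prod>k\<le>n. real (N k))"
  have Q: "Q > 0" unfolding Q_def by (intro prod_pos) (use N in \<open>auto intro: less_le_trans[OF zero_less_numeral]\<close>)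
  have low: "(\<Prod>k\<le>n. (gauss_map ^^ k) z) \<ge> 1 / (2 ^ Suc n * Q)" if z: "z \<in> quotient_box N" for z
  proof -
    have z': "z \<in> {0..1}" "z \<notin> \<rat>" using z by (auto simp: quotient_box_def)
    have "1 / (2 ^ Suc n * Q) = (\<Prod>k\<le>n. 1 / (2 * real (N k)))"
      by (simp add: prod_dividef prod.distrib Q_def)
    also have "\<dots> \<le> (\<Prod>k\<le>n. (gauss_map ^^ k) z)"
    proof (intro prod_mono conjI)
      fix k
      have q: "1 \<le> partial_quotient (Suc k) z" "partial_quotient (Suc k) z + 1 \<le> 2 * int (N k)"
        using z partial_quotient_pos[OF z', of k] by (simp_all add: quotient_box_def zless_imp_add1_zle)
      then have "real_of_int (partial_quotient (Suc k) z) + 1 \<le> 2 * real (N k)" by linarith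
      then have "1 / (2 * real (N k)) \<le> 1 / (real_of_int (partial_quotient (Suc k) z) + 1)"
        using q(1) by (intro divide_left_mono mult_pos_pos) auto
      also have "\<dots> \<le> (gauss_map ^^ k) z" by (rule gauss_iterate_bounds(2)[OF z'])
      finally show "1 / (2 * real (N k)) \<le> (gauss_map ^^ k) z" .
    qed simp
    finally show ?thesis .
  qed
  have half: "(gauss_map ^^ k) z \<le> 1 / 2" if z: "z \<in> quotient_box N" for z k
  proof -
    have z': "z \<in> {0..1}" "z \<notin> \<rat>" using z by (auto simp: quotient_box_def)
    have "int (N k) \<le> partial_quotient (Suc k) z" using z by (simp add: quotient_box_def)
    then have "partial_quotient (Suc k) z \<ge> 2" using N[of k] by linarith
    then have "1 / real_of_int (partial_quotient (Suc k) z) \<le> 1 / 2"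
      by (intro divide_left_mono) auto
    with gauss_iterate_bounds(1)[OF z', of k] show ?thesis by linarith
  qed
  define a b where "a = partial_quotient (Suc n) x" and "b = partial_quotient (Suc n) y"
  define u v where "u = (gauss_map ^^ Suc n) x" and "v = (gauss_map ^^ Suc n) y"
  have uv: "0 < u" "u \<le> 1 / 2" "0 < v" "v \<le> 1 / 2"
    unfolding u_def v_def using half[OF x, of "Suc n"] half[OF y, of "Suc n"]
      gauss_iterate_irrational(2)[OF x', of "Suc n"] gauss_iterate_irrational(2)[OF y', of "Suc n"] by auto
  \<comment> \<open>Since all quotients are at least 2, the tails differ by at most 1/2, which is at
    most half the distance of two distinct integers.\<close>
  have ab: "\<bar>real_of_int a - real_of_int b\<bar> / 2 \<le> \<bar>of_int a + u - (of_int b + v)\<bar>"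
  proof (cases "a = b")
    case False
    then have 1: "\<bar>real_of_int a - real_of_int b\<bar> \<ge> 1" by linarith
    have 2: "\<bar>v - u\<bar> \<le> 1 / 2" using uv by linarith
    have 3: "\<bar>real_of_int a - real_of_int b\<bar> - \<bar>v - u\<bar> \<le> \<bar>(real_of_int a - real_of_int b) - (v - u)\<bar>"
      by (rule abs_triangle_ineq2)
    have 4: "(real_of_int a - real_of_int b) - (v - u) = of_int a + u - (of_int b + v)" by simp
    define d e f where "d = \<bar>real_of_int a - real_of_int b\<bar>" and "e = \<bar>v - u\<bar>"
      and "f = \<bar>of_int a + u - (of_int b + v)\<bar>"
    have "d / 2 \<le> f" using 1 2 3 unfolding 4 d_def[symmetric] e_def[symmetric] f_def[symmetric] by linarith
    then show ?thesis by (simp only: d_def f_def)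
  qed simp
  define X Y where "X = (\<Prod>k\<le>n. (gauss_map ^^ k) x)" and "Y = (\<Prod>k\<le>n. (gauss_map ^^ k) y)"
  define D where "D = 1 / (2 ^ Suc n * Q)"
  have D: "D > 0" "D \<le> X" "D \<le> Y" using low[OF x] low[OF y] Q by (simp_all add: D_def X_def Y_def)
  have eq': "\<bar>x - y\<bar> = (\<Prod>k<n. (gauss_map ^^ k) x * (gauss_map ^^ k) y) *
      \<bar>(gauss_map ^^ n) x - (gauss_map ^^ n) y\<bar>"
    by (rule dist_same_quotients[OF x' y']) (rule eq)
  have eqd: "\<bar>x - y\<bar> = X * Y * \<bar>of_int a + u - (of_int b + v)\<bar>"
    unfolding eq' gauss_iterate_diff[OF x' y'] a_def b_def u_def v_def
      X_def Y_def lessThan_Suc_atMost[symmetric] prod.lessThan_Suc prod.distrib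
    by (simp only: mult_ac)
  have "D * D * (\<bar>real_of_int a - real_of_int b\<bar> / 2) \<le> \<bar>x - y\<bar>"
    unfolding eqd by (rule mult_mono[OF mult_mono ab]) (use D in simp_all)
  then have "\<bar>real_of_int a - real_of_int b\<bar> \<le> 2 * \<bar>x - y\<bar> / (D * D)"
    using D(1) by (simp add: field_simps)
  also have "\<dots> = 2 * (2 ^ Suc n * 2 ^ Suc n) * Q\<^sup>2 * \<bar>x - y\<bar>"
    by (simp add: D_def power2_eq_square)
  also have "(2::real) ^ Suc n * 2 ^ Suc n = 4 ^ Suc n"
    by (simp only: power_mult_distrib[symmetric]) simp
  finally show ?thesis by (simp only: a_def b_def Q_def)
qed

section \<open>Lower bounds: uniform mass on product sets of quotients\<close>

section \<open>Mass distribution\<close>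

lemma emeasure_uniform_product:
  fixes A :: "nat \<Rightarrow> 'a set"
  assumes A: "\<And>k. finite (A k)" "\<And>k. A k \<noteq> {}"
    and X: "\<And>k. k \<le> n \<Longrightarrow> X k \<subseteq> A k"
  defines "P \<equiv> PiM UNIV (\<lambda>k. uniform_count_measure (A k))"
  shows "{\<omega> \<in> space P. \<forall>k\<le>n. \<omega> k \<in> X k} \<in> sets P"
    "emeasure P {\<omega> \<in> space P. \<forall>k\<le>n. \<omega> k \<in> X k} = ennreal (\<Prod>k\<le>n. real (card (X k)) / real (card (A k)))"
proof -
  interpret product_prob_space "\<lambda>k. uniform_count_measure (A k)" UNIV
    by (rule product_prob_spaceI) (rule prob_space_uniform_count_measure[OF A])
  have [measurable]: "X k \<in> sets (uniform_count_measure (A k))" if "k \<le> n" for k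
    using X[OF that] by (simp add: sets_uniform_count_measure)
  show "{\<omega> \<in> space P. \<forall>k\<le>n. \<omega> k \<in> X k} \<in> sets P"
    unfolding P_def by measurable
  have "emeasure P {\<omega> \<in> space P. \<forall>k\<in>{..n}. \<omega> k \<in> X k} =
      (\<Prod>k\<in>{..n}. emeasure (uniform_count_measure (A k)) (X k))"
    unfolding P_def by (rule emeasure_PiM_Collect) auto
  also have "\<dots> = (\<Prod>k\<in>{..n}. ennreal (real (card (X k)) / real (card (A k))))"
    using X A by (intro prod.cong refl emeasure_uniform_count_measure) auto
  also have "\<dots> = ennreal (\<Prod>k\<le>n. real (card (X k)) / real (card (A k)))"
    by (rule prod_ennreal) simp
  finally show "emeasure P {\<omega> \<in> space P. \<forall>k\<le>n. \<omega> k \<in> X k} =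
      ennreal (\<Prod>k\<le>n. real (card (X k)) / real (card (A k)))"
    by (simp add: Ball_def)
qed

lemma real_card_le_diameter:
  fixes J :: "int set"
  assumes "finite J" "\<And>a b. a \<in> J \<Longrightarrow> b \<in> J \<Longrightarrow> real_of_int a - real_of_int b \<le> R" "0 \<le> R"
  shows "real (card J) \<le> R + 1"
proof (cases "J = {}")
  case False
  have "J \<subseteq> {Min J .. Max J}" using assms(1) by auto
  then have "card J \<le> nat (Max J - Min J + 1)"
    using card_mono[of "{Min J .. Max J}" J] by simp
  moreover have "Min J \<le> Max J" using assms(1) False by simp
  moreover have "real_of_int (Max J) - real_of_int (Min J) \<le> R"
    using assms(1,2) False by simp
  ultimately show ?thesis by linarith
qed (use assms in simp)

text \<open>Let n be the first index at which points of the box inside U have different quotients.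
  At that index at most \<open>N n\<close> values occur, and by separation at most a constant times
  diam U. Interpolating between the two counts with exponents 1 - t and t bounds the mass of U by a
  multiple of its diameter to the power t; the hypothesis on \<open>C\<close> is what this
  computation asks for.\<close>

lemma hausdorff_measure_quotient_box:
  assumes N: "\<And>k. N k \<ge> 2" and t: "0 \<le> t" "t < 1"
    and C: "\<And>n. real (N n) powr (1 - t) * (4 ^ (n + 2) * (\<Prod>k\<le>n. real (N k))\<^sup>2) powr t
      \<le> C * (\<Prod>k\<le>n. real (N k))"
  shows "hausdorff_measure t (quotient_box N) \<noteq> 0"
proof -
  define A where "A k = {int (N k)..<2 * int (N k)}" for k
  define P where "P = PiM UNIV (\<lambda>k. uniform_count_measure (A k))"
  define Q where "Q n = (\<Prod>k\<le>n. real (N k))" for n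
  have A: "finite (A k)" "A k \<noteq> {}" "card (A k) = N k" for k
    using N[of k] by (auto simp: A_def)
  have Np: "real (N k) > 0" for k using N[of k] by simp
  have Q: "Q n > 0" for n unfolding Q_def by (intro prod_pos) (use Np in auto)
  have Q2: "Q n \<ge> 2 ^ n" for n
  proof -
    have "2 ^ n \<le> (2::real) ^ card {..n}" by simp
    also have "\<dots> = (\<Prod>k\<le>n. 2)" by simp
    also have "\<dots> \<le> Q n" unfolding Q_def by (intro prod_mono) (use N in auto)
    finally show ?thesis .
  qed
  interpret P: prob_space P
    unfolding P_def using A by (intro prob_space_PiM prob_space_uniform_count_measure) auto
  note cyl = emeasure_uniform_product[of A, OF A(1,2), folded P_def, unfolded A(3)]
  have space_P: "space P = (\<Pi>\<^sub>E k\<in>UNIV. A k)" by (simp add: P_def space_PiM space_uniform_count_measure)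
  define code where "code \<omega> x \<longleftrightarrow> x \<in> quotient_box N \<and> (\<forall>k. partial_quotient (Suc k) x = \<omega> k)" for \<omega> x
  have "\<exists>x. code \<omega> x" if "\<omega> \<in> space P" for \<omega>
  proof -
    have \<omega>: "int (N k) \<le> \<omega> k" "\<omega> k < 2 * int (N k)" for k
      using that by (auto simp: space_P A_def)
    have "nat (\<omega> k) \<ge> 1" for k using \<omega>(1)[of k] N[of k] by linarith
    from exists_partial_quotients[of "\<lambda>k. nat (\<omega> k)", OF this] obtain x
      where x: "x \<in> {0..1}" "x \<notin> \<rat>" "\<And>k. partial_quotient (Suc k) x = int (nat (\<omega> k))" by blast
    have "int (nat (\<omega> k)) = \<omega> k" for k using \<omega>(1)[of k] N[of k] by linarith
    with x \<omega> show ?thesis by (intro exI[of _ x]) (auto simp: code_def quotient_box_def)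
  qed
  then obtain pt where "\<And>\<omega>. \<omega> \<in> space P \<Longrightarrow> code \<omega> (pt \<omega>)" by metis
  then have pt: "pt \<omega> \<in> quotient_box N" "partial_quotient (Suc k) (pt \<omega>) = \<omega> k" if "\<omega> \<in> space P" for \<omega> k
    using that by (auto simp: code_def)
  define C' where "C' = max C 1"
  have C': "C' > 0" by (simp add: C'_def)
  \<comment> \<open>Neither \<open>U\<close> nor the chosen map \<open>pt\<close> need be
    measurable, so the preimage is enclosed in a measurable set instead of being measured.\<close>
  have cover: "\<exists>Z\<in>sets P. {\<omega> \<in> space P. pt \<omega> \<in> U} \<subseteq> Z \<and> emeasure P Z \<le> ennreal C' * diam_powr t U"
    if U: "bounded U" for U
  proof -
    \<comment> \<open>The indices at which U still distinguishes points of the box. If there are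
      none, at most one sequence is left; otherwise the least index sets the scale of U.\<close>
    define D where "D = {n. \<exists>x\<in>U \<inter> quotient_box N. \<exists>y\<in>U \<inter> quotient_box N.
        partial_quotient (Suc n) x \<noteq> partial_quotient (Suc n) y}"
    have D0: "partial_quotient (Suc k) x = partial_quotient (Suc k) y"
      if "k \<notin> D" "x \<in> U \<inter> quotient_box N" "y \<in> U \<inter> quotient_box N" for k x y
      using that unfolding D_def by blast
    consider "U \<inter> quotient_box N = {}" | x0 where "x0 \<in> U \<inter> quotient_box N" "D = {}"
      | x0 where "x0 \<in> U \<inter> quotient_box N" "D \<noteq> {}" by (cases "U \<inter> quotient_box N = {}"; cases "D = {}") auto
    then show ?thesis
    proof cases
      case 1
      then have "{\<omega> \<in> space P. pt \<omega> \<in> U} = {}" using pt(1) by blast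
      then show ?thesis by (intro bexI[of _ "{}"]) auto
    next
      case (2 x0)
      define w where "w k = partial_quotient (Suc k) x0" for k
      have w: "{w k} \<subseteq> A k" for k using 2 by (auto simp: w_def A_def quotient_box_def)
      \<comment> \<open>Cylinders shrinking to the single sequence \<open>w\<close>; their masses
        \<open>1 / Q n\<close> tend to 0.\<close>
      define Z where "Z n = {\<omega> \<in> space P. \<forall>k\<le>n. \<omega> k \<in> {w k}}" for n
      have Z: "Z n \<in> sets P" for n unfolding Z_def by (rule cyl(1)) (rule w)
      have eZ: "emeasure P (Z n) \<le> ennreal ((1 / 2) ^ n)" for n
      proof -
        have "emeasure P (Z n) = ennreal (\<Prod>k\<le>n. real (card {w k}) / real (N k))"
          unfolding Z_def by (rule cyl(2)) (rule w)
        also have "(\<Prod>k\<le>n. real (card {w k}) / real (N k)) = 1 / Q n"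
          by (simp add: Q_def prod_dividef)
        also have "1 / Q n \<le> 1 / 2 ^ n" using Q2[of n] Q[of n] by (intro divide_left_mono) auto
        finally show ?thesis by (simp add: power_one_over ennreal_leI)
      qed
      have "emeasure P (\<Inter>n. Z n) \<le> ennreal ((1 / 2) ^ n)" for n
        by (rule order_trans[OF emeasure_mono eZ]) (use Z in auto)
      moreover have "(\<lambda>n. ennreal ((1 / 2) ^ n)) \<longlonglongrightarrow> ennreal 0"
        by (intro tendsto_ennrealI LIMSEQ_power_zero) simp
      ultimately have "emeasure P (\<Inter>n. Z n) \<le> ennreal 0"
        by (intro tendsto_lowerbound[of _ _ sequentially]) auto
      then have "emeasure P (\<Inter>n. Z n) \<le> ennreal C' * diam_powr t U" by simp
      moreover have "{\<omega> \<in> space P. pt \<omega> \<in> U} \<subseteq> (\<Inter>n. Z n)"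
      proof
        fix \<omega> assume \<omega>: "\<omega> \<in> {\<omega> \<in> space P. pt \<omega> \<in> U}"
        have "\<omega> k = w k" for k
        proof -
          have p: "pt \<omega> \<in> U \<inter> quotient_box N" using \<omega> pt(1) by simp
          have "k \<notin> D" using 2(2) by simp
          then have "partial_quotient (Suc k) (pt \<omega>) = partial_quotient (Suc k) x0"
            using p 2(1) by (rule D0)
          then show ?thesis using pt(2)[of \<omega> k] \<omega> by (simp add: w_def)
        qed
        then show "\<omega> \<in> (\<Inter>n. Z n)" using \<omega> by (simp add: Z_def)
      qed
      moreover have "(\<Inter>n. Z n) \<in> sets P" using Z by blast
      ultimately show ?thesis by blast
    next
      case (3 x0)
      define n where "n = (LEAST n. n \<in> D)"
      obtain m where "m \<in> D" using 3(2) by auto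
      then have n: "n \<in> D" unfolding n_def by (rule LeastI[of "\<lambda>n. n \<in> D"])
      have same: "partial_quotient (Suc k) x = partial_quotient (Suc k) y"
        if "k < n" "x \<in> U \<inter> quotient_box N" "y \<in> U \<inter> quotient_box N" for k x y
      proof -
        have "k \<notin> D" using that(1) unfolding n_def by (rule not_less_Least[of k "\<lambda>n. n \<in> D"])
        then show ?thesis using that(2,3) by (rule D0)
      qed
      define R where "R = 2 * 4 ^ Suc n * (Q n)\<^sup>2 * diameter U"
      have sep: "\<bar>real_of_int (partial_quotient (Suc n) x) - real_of_int (partial_quotient (Suc n) y)\<bar> \<le> R"
        if x: "x \<in> U \<inter> quotient_box N" and y: "y \<in> U \<inter> quotient_box N" for x y
      proof -
        have "\<bar>real_of_int (partial_quotient (Suc n) x) - real_of_int (partial_quotient (Suc n) y)\<bar>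
            \<le> 2 * 4 ^ Suc n * (\<Prod>k\<le>n. real (N k))\<^sup>2 * \<bar>x - y\<bar>"
          using quotient_box_separation[OF N _ _ same[OF _ x y]] x y by simp
        also have "\<dots> \<le> R"
        proof -
          have "\<bar>x - y\<bar> \<le> diameter U"
            using x y diameter_bounded_bound[OF U, of x y] by (simp add: dist_real_def)
          then show ?thesis unfolding R_def Q_def by (rule mult_left_mono) simp
        qed
        finally show ?thesis .
      qed
      \<comment> \<open>Two distinct integers differ by at least 1. This makes the diameter positive
        and allows \<open>R + 1\<close> to be replaced by \<open>2 * R\<close>.\<close>
      have R1: "R \<ge> 1"
      proof -
        from n obtain x y where xy: "x \<in> U \<inter> quotient_box N" "y \<in> U \<inter> quotient_box N"
          "partial_quotient (Suc n) x \<noteq> partial_quotient (Suc n) y" unfolding D_def by blast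
        from sep[OF xy(1,2)] xy(3) show ?thesis by linarith
      qed
      have dpos: "diameter U > 0"
        using R1 diameter_ge_0[OF U] unfolding R_def by (cases "diameter U = 0") auto
      define J where "J = (\<lambda>x. partial_quotient (Suc n) x) ` (U \<inter> quotient_box N)"
      have J: "J \<subseteq> A n" by (auto simp: J_def A_def quotient_box_def)
      then have finJ: "finite J" using A(1) finite_subset by blast
      have J0: "card J > 0" using finJ 3(1) by (auto simp: card_gt_0_iff J_def)
      have cJN: "real (card J) \<le> real (N n)" using card_mono[OF A(1) J] A(3) by simp
      have "real (card J) \<le> R + 1"
        using R1 sep by (intro real_card_le_diameter finJ) (auto simp: J_def abs_le_iff)
      then have cJR: "real (card J) \<le> 2 * R" using R1 by simp
      \<comment> \<open>The first factor is bounded by the block size \<open>N n\<close>, the second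
        by the separation count \<open>2 * R\<close>.\<close>
      have "real (card J) = real (card J) powr (1 - t) * real (card J) powr t"
        using J0 by (simp add: powr_add[symmetric])
      also have "\<dots> \<le> real (N n) powr (1 - t) * (2 * R) powr t"
        using cJN cJR t by (intro mult_mono powr_mono2) auto
      also have "2 * R = (4 ^ (n + 2) * (Q n)\<^sup>2) * diameter U" by (simp add: R_def)
      also have "real (N n) powr (1 - t) * ((4 ^ (n + 2) * (Q n)\<^sup>2) * diameter U) powr t =
          (real (N n) powr (1 - t) * (4 ^ (n + 2) * (Q n)\<^sup>2) powr t) * diameter U powr t"
        using dpos by (subst powr_mult) auto
      also have "\<dots> \<le> (C * Q n) * diameter U powr t"
        using C[of n] by (intro mult_right_mono) (auto simp: Q_def)
      also have "\<dots> \<le> (C' * Q n) * diameter U powr t"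
        using Q[of n] by (intro mult_right_mono) (auto simp: C'_def)
      finally have card_le: "real (card J) / Q n \<le> C' * diameter U powr t"
        using Q[of n] by (simp add: field_simps)
      \<comment> \<open>One letter at each coordinate before n, where all points of U in the box
        agree, and the set \<open>J\<close> of occurring letters at n.\<close>
      define X where "X k = (if k < n then {partial_quotient (Suc k) x0} else J)" for k
      define Z where "Z = {\<omega> \<in> space P. \<forall>k\<le>n. \<omega> k \<in> X k}"
      have X: "X k \<subseteq> A k" if "k \<le> n" for k
        using that 3(1) J by (cases "k = n") (auto simp: X_def A_def quotient_box_def)
      have "Z \<in> sets P" unfolding Z_def by (rule cyl(1)) (rule X)
      moreover have "{\<omega> \<in> space P. pt \<omega> \<in> U} \<subseteq> Z"
      proof
        fix \<omega> assume \<omega>: "\<omega> \<in> {\<omega> \<in> space P. pt \<omega> \<in> U}"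
        then have p: "pt \<omega> \<in> U \<inter> quotient_box N" using pt(1) by auto
        have "\<omega> k \<in> X k" if "k \<le> n" for k
        proof (cases "k < n")
          case True
          then show ?thesis using same[OF True p 3(1)] pt(2)[of \<omega> k] \<omega> by (simp add: X_def)
        next
          case False
          then have "k = n" using that by simp
          then show ?thesis using p pt(2)[of \<omega> n] \<omega> by (force simp: X_def J_def)
        qed
        then show "\<omega> \<in> Z" using \<omega> by (simp add: Z_def)
      qed
      moreover have "emeasure P Z \<le> ennreal C' * diam_powr t U"
      proof -
        have "emeasure P Z = ennreal (\<Prod>k\<le>n. real (card (X k)) / real (N k))"
          unfolding Z_def by (rule cyl(2)) (rule X)
        also have "(\<Prod>k\<le>n. real (card (X k)) / real (N k)) = (\<Prod>k\<le>n. real (card (X k))) / Q n"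
          by (simp add: Q_def prod_dividef)
        also have "(\<Prod>k\<le>n. real (card (X k))) = real (card J)"
          by (simp add: lessThan_Suc_atMost[symmetric] X_def)
        also have "ennreal (real (card J) / Q n) \<le> ennreal (C' * diameter U powr t)"
          using card_le by (rule ennreal_leI)
        also have "\<dots> = ennreal C' * diam_powr t U"
          using 3(1) dpos C' by (auto simp: diam_powr_def ennreal_mult)
        finally show ?thesis .
      qed
      ultimately show ?thesis by blast
    qed
  qed
  show ?thesis
  proof (rule hausdorff_measure_neq_0I[OF C'])
    fix U :: "nat \<Rightarrow> real set"
    assume U: "quotient_box N \<subseteq> (\<Union>i. U i)" "\<And>i. bounded (U i)"
    define covers where "covers i Z \<longleftrightarrow> Z \<in> sets P \<and> {\<omega> \<in> space P. pt \<omega> \<in> U i} \<subseteq> Z \<and>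
        emeasure P Z \<le> ennreal C' * diam_powr t (U i)" for i Z
    have "\<exists>Z. covers i Z" for i
      using cover[OF U(2)[of i]] by (simp only: covers_def Bex_def)
    then obtain Z where "\<And>i. covers i (Z i)" by metis
    then have Z: "Z i \<in> sets P" "{\<omega> \<in> space P. pt \<omega> \<in> U i} \<subseteq> Z i"
      "emeasure P (Z i) \<le> ennreal C' * diam_powr t (U i)" for i by (simp_all only: covers_def)
    have "space P \<subseteq> (\<Union>i. Z i)"
    proof
      fix \<omega> assume \<omega>: "\<omega> \<in> space P"
      from U(1) pt(1)[OF \<omega>] obtain i where "pt \<omega> \<in> U i" by blast
      then show "\<omega> \<in> (\<Union>i. Z i)" using Z(2)[of i] \<omega> by blast
    qed
    then have 1: "1 \<le> emeasure P (\<Union>i. Z i)"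
      using emeasure_mono[of "space P" "\<Union>i. Z i" P] Z(1) by (simp add: P.emeasure_space_1)
    have 2: "emeasure P (\<Union>i. Z i) \<le> (\<Sum>i. emeasure P (Z i))"
      using Z(1) by (intro emeasure_subadditive_countably) auto
    have 3: "(\<Sum>i. emeasure P (Z i)) \<le> (\<Sum>i. ennreal C' * diam_powr t (U i))"
      using Z(3) by (intro suminf_le) auto
    show "1 \<le> (\<Sum>i. ennreal C' * diam_powr t (U i))"
      by (rule order_trans[OF 1 order_trans[OF 2 3]])
  qed
qed

text \<open>With blocks of size about exp(s (k + 1) - s k), the logarithm of the product of the
  first n block sizes is s n up to O(n). The mass condition then reduces to t \<beta> s n - (1 - t)
  s n being bounded above after adding O(n), which holds because the coefficient t (1 + \<beta>) - 1
  is negative and s is superlinear.\<close>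

lemma hausdorff_measure_prescribed_growth:
  fixes s :: "nat \<Rightarrow> real"
  assumes s: "mono s" and lin: "filterlim (\<lambda>n. s n / real n) at_top sequentially"
    and growth: "\<And>n. s (Suc n) \<le> \<beta> * s n" and \<beta>: "\<beta> \<ge> 1"
    and t: "0 \<le> t" "t * (1 + \<beta>) < 1"
  shows "hausdorff_measure t {x \<in> {0..1}. x \<notin> \<rat> \<and> (\<lambda>n. log_pq_sum n x / s n) \<longlonglongrightarrow> 1} \<noteq> 0"
    (is "hausdorff_measure t ?K \<noteq> 0")
proof -
  define d where "d k = s (Suc k) - s k" for k
  \<comment> \<open>The added 1 ensures \<open>N k \<ge> 2\<close>, and the size stays within a
    factor 3 of \<open>exp (d k)\<close>.\<close>
  define N where "N k = nat \<lceil>exp (d k)\<rceil> + 1" for k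
  define q where "q n = (\<Sum>k<n. ln (real (N k)))" for n
  have d: "d k \<ge> 0" for k using monoD[OF s, of k "Suc k"] by (simp add: d_def)
  have sum_d: "(\<Sum>k<n. d k) = s n - s 0" for n
    unfolding d_def by (rule sum_lessThan_telescope)
  have e1: "exp (d k) \<ge> 1" for k using d by simp
  have N2: "N k \<ge> 2" for k
  proof -
    have "\<lceil>exp (d k)\<rceil> \<ge> 1" using e1[of k] by linarith
    then show ?thesis unfolding N_def by linarith
  qed
  have N_ge: "exp (d k) \<le> real (N k)" for k unfolding N_def by linarith
  have N_le: "real (N k) \<le> 3 * exp (d k)" for k using e1[of k] unfolding N_def by linarith
  have Np: "real (N k) > 0" for k using N2[of k] by simp
  have ln3: "ln 3 \<le> (2::real)" using ln_le_minus_one[of 3] by simp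
  have ln4: "ln 4 \<le> (3::real)" using ln_le_minus_one[of 4] by simp
  have ln2: "ln 2 \<le> (1::real)" using ln_le_minus_one[of 2] by simp
  have lnN: "d k \<le> ln (real (N k))" "ln (real (N k)) \<le> d k + 2" for k
  proof -
    show "d k \<le> ln (real (N k))" using N_ge[of k] Np[of k] by (simp add: ln_ge_iff)
    have "ln (real (N k)) \<le> ln (3 * exp (d k))" using N_le[of k] Np[of k] by (subst ln_le_cancel_iff) auto
    also have "\<dots> = ln 3 + d k" by (simp add: ln_mult)
    finally show "ln (real (N k)) \<le> d k + 2" using ln3 by linarith
  qed
  have q_ge: "s n - s 0 \<le> q n" for n
    unfolding q_def sum_d[symmetric] by (intro sum_mono lnN)
  have q_le: "q n \<le> s n - s 0 + 2 * real n" for n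
  proof -
    have "q n \<le> (\<Sum>k<n. d k + 2)" unfolding q_def by (intro sum_mono lnN)
    also have "\<dots> = s n - s 0 + 2 * real n" by (simp add: sum.distrib sum_d)
    finally show ?thesis .
  qed
  have exp_q: "(\<Prod>k\<le>n. real (N k)) = exp (q (Suc n))" for n
  proof -
    have "exp (q (Suc n)) = (\<Prod>k<Suc n. exp (ln (real (N k))))" unfolding q_def by (rule exp_sum) simp
    also have "\<dots> = (\<Prod>k\<le>n. real (N k))" using Np by (simp add: lessThan_Suc_atMost)
    finally show ?thesis by simp
  qed
  define \<gamma> where "\<gamma> = 1 - t * (1 + \<beta>)"
  have \<gamma>: "\<gamma> > 0" using t by (simp add: \<gamma>_def)
  have "t * 1 \<le> t * (1 + \<beta>)" using \<beta> t(1) by (intro mult_left_mono) auto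
  then have t1: "t < 1" using t(2) by simp
  have "\<forall>\<^sub>F n in sequentially. s n / real n \<ge> 5 / \<gamma>"
    using lin by (simp add: filterlim_at_top)
  then obtain m where m: "\<And>n. n \<ge> m \<Longrightarrow> s n / real n \<ge> 5 / \<gamma>"
    unfolding eventually_sequentially by blast
  \<comment> \<open>The 5 collects the linear errors 2n from rounding the block sizes and 3n from
    the powers of 4. They are absorbed by the slack \<gamma> times s n, and \<open>M\<close> covers
    the finitely many small n.\<close>
  define M where "M = 5 * real m + \<gamma> * \<bar>s 0\<bar>"
  have M: "5 * real n \<le> \<gamma> * s n + M" for n
  proof -
    have "s 0 \<le> s n" using s by (simp add: monoD)
    then have "- \<bar>s 0\<bar> \<le> s n" by linarith
    then have "\<gamma> * (- \<bar>s 0\<bar>) \<le> \<gamma> * s n" using \<gamma> by (intro mult_left_mono) auto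
    then have 0: "0 \<le> \<gamma> * s n + \<gamma> * \<bar>s 0\<bar>" by simp
    show ?thesis
    proof (cases "n \<ge> m \<and> n > 0")
      case True
      then have "5 * real n \<le> \<gamma> * s n" using m[of n] \<gamma> by (simp add: field_simps)
      moreover have "0 \<le> \<gamma> * \<bar>s 0\<bar>" using \<gamma> by simp
      ultimately show ?thesis unfolding M_def by linarith
    next
      case False
      then have "real n \<le> real m" by auto
      then show ?thesis using 0 unfolding M_def by linarith
    qed
  qed
  \<comment> \<open>The 8 is the constant part 2 + 6 of those errors, from \<open>2 * Suc n\<close>
    and \<open>3 * (n + 2)\<close>; the term in \<open>s 0\<close> bounds
    \<open>(1 - 2 * t) * s 0\<close>.\<close>
  define C where "C = exp (M + \<bar>s 0\<bar> + 8)"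
  have "hausdorff_measure t (quotient_box N) \<noteq> 0"
  proof (rule hausdorff_measure_quotient_box[OF N2 t(1) t1])
    fix n
    have Nn: "ln (real (N n)) = q (Suc n) - q n" by (simp add: q_def)
    have "t * (q (Suc n)) \<le> t * (\<beta> * s n - s 0 + 2 * real (Suc n))"
      using q_le[of "Suc n"] growth[of n] t(1) by (intro mult_left_mono) linarith+
    moreover have "(1 - t) * (s n - s 0) \<le> (1 - t) * q n"
      using q_ge[of n] t1 by (intro mult_left_mono) auto
    moreover have "t * (real (n + 2) * ln 4) \<le> 1 * (real (n + 2) * 3)"
      using t1 t(1) ln4 by (intro mult_mono) auto
    moreover have "t * (2 * real (Suc n)) \<le> 1 * (2 * real (Suc n))"
      using t1 by (intro mult_right_mono) auto
    moreover have "(1 - 2 * t) * s 0 \<le> \<bar>1 - 2 * t\<bar> * \<bar>s 0\<bar>"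
      by (metis abs_ge_self abs_mult)
    moreover have "\<bar>1 - 2 * t\<bar> * \<bar>s 0\<bar> \<le> 1 * \<bar>s 0\<bar>" using t1 t(1) by (intro mult_right_mono) auto
    ultimately have "(1 - t) * (q (Suc n) - q n) + t * (real (n + 2) * ln 4 + 2 * q (Suc n))
        \<le> M + \<bar>s 0\<bar> + 8 + q (Suc n)"
      using M[of n] unfolding \<gamma>_def by (simp add: algebra_simps)
    moreover have "real (N n) powr (1 - t) = exp ((1 - t) * (q (Suc n) - q n))"
      using Np[of n] N2[of n] by (simp add: powr_def Nn)
    moreover have "(4 ^ (n + 2) * (\<Prod>k\<le>n. real (N k))\<^sup>2) powr t =
        exp (t * (real (n + 2) * ln 4 + 2 * q (Suc n)))"
    proof -
      have "ln (4 ^ (n + 2) * (exp (q (Suc n)))\<^sup>2) = real (n + 2) * ln 4 + 2 * q (Suc n)"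
        by (subst ln_mult) (simp_all only: ln_realpow ln_exp zero_less_power zero_less_numeral exp_gt_zero, simp)
      then show ?thesis unfolding exp_q powr_def by simp
    qed
    ultimately show "real (N n) powr (1 - t) * (4 ^ (n + 2) * (\<Prod>k\<le>n. real (N k))\<^sup>2) powr t
        \<le> C * (\<Prod>k\<le>n. real (N k))"
      unfolding C_def exp_q by (simp add: exp_add[symmetric])
  qed
  moreover have "quotient_box N \<subseteq> ?K"
  proof
    fix x assume x: "x \<in> quotient_box N"
    \<comment> \<open>A quotient is at most twice \<open>N k\<close>, which adds
      \<open>ln 2 \<le> 1\<close> to the rounding error 2.\<close>
    have lnpq: "d k \<le> ln (real_of_int (partial_quotient (Suc k) x))"
      "ln (real_of_int (partial_quotient (Suc k) x)) \<le> d k + 3" for k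
    proof -
      have "int (N k) \<le> partial_quotient (Suc k) x" "partial_quotient (Suc k) x < 2 * int (N k)"
        using x by (auto simp: quotient_box_def)
      then have *: "real (N k) \<le> real_of_int (partial_quotient (Suc k) x)"
        "real_of_int (partial_quotient (Suc k) x) \<le> 2 * real (N k)" by linarith+
      have p: "real_of_int (partial_quotient (Suc k) x) > 0" using *(1) Np[of k] by linarith
      have "ln (real (N k)) \<le> ln (real_of_int (partial_quotient (Suc k) x))"
        using *(1) Np[of k] p by (subst ln_le_cancel_iff) auto
      then show "d k \<le> ln (real_of_int (partial_quotient (Suc k) x))" using lnN(1)[of k] by linarith
      have "ln (real_of_int (partial_quotient (Suc k) x)) \<le> ln (2 * real (N k))"
        using *(2) Np[of k] p by (subst ln_le_cancel_iff) auto
      also have "\<dots> = ln 2 + ln (real (N k))" using Np[of k] by (simp add: ln_mult)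
      finally show "ln (real_of_int (partial_quotient (Suc k) x)) \<le> d k + 3"
        using lnN(2)[of k] ln2 by linarith
    qed
    have lower: "s n - s 0 \<le> log_pq_sum n x" for n
      unfolding log_pq_sum_eq sum_d[symmetric] by (intro sum_mono lnpq)
    have upper: "log_pq_sum n x \<le> s n - s 0 + 3 * real n" for n
    proof -
      have "log_pq_sum n x \<le> (\<Sum>k<n. d k + 3)" unfolding log_pq_sum_eq by (intro sum_mono lnpq)
      also have "\<dots> = s n - s 0 + 3 * real n" by (simp add: sum.distrib sum_d)
      finally show ?thesis .
    qed
    \<comment> \<open>The total error is at most \<bar>s 0\<bar> + 3n, which is negligible against
      the superlinear s.\<close>
    have "(\<lambda>n. log_pq_sum n x / s n - 1) \<longlonglongrightarrow> 0"
    proof (rule Lim_null_comparison)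
      have "\<forall>\<^sub>F n in sequentially. s n / real n \<ge> 1"
        using lin by (simp add: filterlim_at_top)
      moreover have "\<forall>\<^sub>F n in sequentially. n \<ge> (1::nat)" by (rule eventually_ge_at_top)
      ultimately show "\<forall>\<^sub>F n in sequentially. norm (log_pq_sum n x / s n - 1)
          \<le> (3 + \<bar>s 0\<bar>) * inverse (s n / real n)"
      proof eventually_elim
        case (elim n)
        then have sn: "s n > 0" by (auto simp: le_divide_eq)
        have "\<bar>log_pq_sum n x - s n\<bar> \<le> \<bar>s 0\<bar> + 3 * real n" using lower[of n] upper[of n] by linarith
        also have "\<dots> \<le> (3 + \<bar>s 0\<bar>) * real n"
        proof -
          have "\<bar>s 0\<bar> * 1 \<le> \<bar>s 0\<bar> * real n" using elim(2) by (intro mult_left_mono) auto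
          then show ?thesis by (simp add: algebra_simps)
        qed
        finally have "\<bar>log_pq_sum n x - s n\<bar> / s n \<le> (3 + \<bar>s 0\<bar>) * real n / s n"
          using sn by (intro divide_right_mono) auto
        moreover have "\<bar>log_pq_sum n x / s n - 1\<bar> = \<bar>log_pq_sum n x - s n\<bar> / s n"
        proof -
          have "log_pq_sum n x / s n - 1 = (log_pq_sum n x - s n) / s n" using sn by (simp add: diff_divide_distrib)
          then show ?thesis using sn by simp
        qed
        ultimately show ?case by (simp add: field_simps)
      qed
      show "(\<lambda>n. (3 + \<bar>s 0\<bar>) * inverse (s n / real n)) \<longlonglongrightarrow> 0"
        by (rule tendsto_mult_right_zero) (rule tendsto_inverse_0_at_top[OF lin])
    qed
    then have "(\<lambda>n. log_pq_sum n x / s n) \<longlonglongrightarrow> 1" by (rule LIM_zero_cancel)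
    then show "x \<in> {x \<in> {0..1}. x \<notin> \<rat> \<and> (\<lambda>n. log_pq_sum n x / s n) \<longlonglongrightarrow> 1}"
      using x by (simp add: quotient_box_def)
  qed
  then have "hausdorff_measure t (quotient_box N) \<le> hausdorff_measure t ?K"
    by (rule hausdorff_measure_mono)
  ultimately show ?thesis by auto
qed

section \<open>Regular sequences below and above a given one that meet it infinitely often\<close>

section \<open>Envelopes of controlled growth\<close>

text \<open>Applied with r n = \<open>log_pq_sum n x / s n\<close>, which converges to 1, and
  \<open>X\<close> the same quotient with \<psi> in place of s. Domination needs only the envelope
  inequality, and the touching points prevent a smaller limsup.\<close>

lemma limsup_eqI_frequently:
  fixes X r :: "nat \<Rightarrow> ereal"
  assumes r: "r \<longlonglongrightarrow> L" and le: "\<forall>\<^sub>F n in sequentially. X n \<le> r n"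
    and eq: "\<exists>\<^sub>F n in sequentially. X n = r n"
  shows "limsup X = L"
proof (rule antisym)
  have "limsup X \<le> limsup r" by (rule Limsup_mono[OF le])
  also have "limsup r = L" by (rule lim_imp_Limsup[OF _ r]) simp
  finally show "limsup X \<le> L" .
  show "L \<le> limsup X"
  proof (rule ccontr)
    assume "\<not> L \<le> limsup X"
    then have "limsup X < L" by simp
    from dense[OF this] obtain y where y: "limsup X < y" "y < L" by blast
    have "\<forall>\<^sub>F n in sequentially. X n < y" by (rule Limsup_lessD[OF y(1)])
    moreover have "\<forall>\<^sub>F n in sequentially. y < r n" by (rule order_tendstoD(1)[OF r y(2)])
    ultimately have "\<forall>\<^sub>F n in sequentially. X n \<noteq> r n" by eventually_elim auto
    with eq show False by (simp add: frequently_def)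
  qed
qed

lemma liminf_eqI_frequently:
  fixes X r :: "nat \<Rightarrow> ereal"
  assumes r: "r \<longlonglongrightarrow> L" and ge: "\<forall>\<^sub>F n in sequentially. r n \<le> X n"
    and eq: "\<exists>\<^sub>F n in sequentially. X n = r n"
  shows "liminf X = L"
proof (rule antisym)
  have "liminf r = L" by (rule lim_imp_Liminf[OF _ r]) simp
  then show "L \<le> liminf X" using Liminf_mono[OF ge] by simp
  show "liminf X \<le> L"
  proof (rule ccontr)
    assume "\<not> liminf X \<le> L"
    then have "L < liminf X" by simp
    from dense[OF this] obtain y where y: "L < y" "y < liminf X" by blast
    have "\<forall>\<^sub>F n in sequentially. y < X n" by (rule less_LiminfD[OF y(2)])
    moreover have "\<forall>\<^sub>F n in sequentially. r n < y" by (rule order_tendstoD(2)[OF r y(1)])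
    ultimately have "\<forall>\<^sub>F n in sequentially. X n \<noteq> r n" by eventually_elim auto
    with eq show False by (simp add: frequently_def)
  qed
qed

lemma filterlim_exponential_over_linear:
  fixes c C :: real
  assumes "c > 1" "C > 0"
  shows "filterlim (\<lambda>n. C * c ^ n / real n) at_top sequentially"
  using assms by real_asymp

text \<open>The hypothesis \<open>small\<close> forces contact: an envelope that never touched would
  grow exactly like a multiple of \<open>\<beta> ^ n\<close> and overtake \<open>f\<close>. The
  exponential lower bound on \<open>f\<close> passes to the envelope because
  \<open>c \<le> \<beta>\<close>, and makes it superlinear.\<close>

lemma exists_lower_envelope:
  fixes f :: "nat \<Rightarrow> nat" and c C \<beta> :: real
  assumes c: "1 < c" "c \<le> \<beta>" and C: "C > 0" "\<And>n. C * c ^ n \<le> real (f n)"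
    and small: "\<And>\<kappa>. \<kappa> > 0 \<Longrightarrow> \<exists>\<^sub>F n in sequentially. real (f n) < \<kappa> * \<beta> ^ n"
  obtains s :: "nat \<Rightarrow> real" where "mono s" "filterlim (\<lambda>n. s n / real n) at_top sequentially"
    "\<And>n. s (Suc n) \<le> \<beta> * s n" "\<And>n. s n > 0" "\<And>n. s n \<le> real (f n)"
    "\<exists>\<^sub>F n in sequentially. s n = real (f n)"
proof -
  \<comment> \<open>The largest nondecreasing minorant; the infimum is attained because the values
    are natural numbers.\<close>
  define \<phi> where "\<phi> n = Inf (f ` {n..})" for n
  have \<phi>_le: "\<phi> n \<le> f k" if "n \<le> k" for n k
    unfolding \<phi>_def using that by (intro wellorder_Inf_le1) auto
  have \<phi>_ex: "\<exists>k\<ge>n. \<phi> n = f k" for n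
  proof -
    have "\<phi> n \<in> f ` {n..}" unfolding \<phi>_def by (rule Inf_nat_def1) auto
    then show ?thesis by auto
  qed
  have \<phi>_mono: "\<phi> m \<le> \<phi> n" if "m \<le> n" for m n
  proof -
    obtain k where "k \<ge> n" "\<phi> n = f k" using \<phi>_ex by blast
    then show ?thesis using \<phi>_le[of m k] that by simp
  qed
  have \<phi>_ge: "C * c ^ n \<le> real (\<phi> n)" for n
  proof -
    obtain k where k: "k \<ge> n" "\<phi> n = f k" using \<phi>_ex by blast
    have "c ^ n \<le> c ^ k" using k(1) c by (intro power_increasing) auto
    then have "C * c ^ n \<le> C * c ^ k" using C(1) by (intro mult_left_mono) auto
    then show ?thesis using C(2)[of k] k(2) by simp
  qed
  \<comment> \<open>Greedy choice: grow by the factor \<beta> unless that exceeds \<phi>.\<close>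
  define s where "s = rec_nat (real (\<phi> 0)) (\<lambda>n r. min (\<beta> * r) (real (\<phi> (Suc n))))"
  have s0: "s 0 = real (\<phi> 0)" and sS: "s (Suc n) = min (\<beta> * s n) (real (\<phi> (Suc n)))" for n
    by (simp_all add: s_def)
  have s_le: "s n \<le> real (\<phi> n)" for n by (cases n) (simp_all add: s0 sS)
  have s_ge: "C * c ^ n \<le> s n" for n
  proof (induction n)
    case 0
    then show ?case using \<phi>_ge[of 0] by (simp add: s0)
  next
    case (Suc n)
    have "c * (C * c ^ n) \<le> \<beta> * s n" using Suc c C(1) by (intro mult_mono) auto
    then show ?case using \<phi>_ge[of "Suc n"] by (simp add: sS mult_ac)
  qed
  have s_pos: "s n > 0" for n
  proof -
    have "0 < C * c ^ n" using C(1) c by simp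
    then show ?thesis using s_ge[of n] by linarith
  qed
  have s_mono: "mono s"
  proof (rule incseq_SucI)
    fix n
    have "s n \<le> \<beta> * s n" using s_pos[of n] c by simp
    moreover have "s n \<le> real (\<phi> (Suc n))" using s_le[of n] \<phi>_mono[of n "Suc n"] by simp
    ultimately show "s n \<le> s (Suc n)" by (simp add: sS)
  qed
  have touch: "\<exists>n\<ge>m. s n = real (\<phi> n)" for m
  proof (rule ccontr)
    assume "\<not> ?thesis"
    then have neq: "s n \<noteq> real (\<phi> n)" if "n \<ge> m" for n using that by auto
    have sn: "s n = s m * \<beta> ^ (n - m)" if "n \<ge> m" for n
      using that
    proof (induction n rule: dec_induct)
      case (step n)
      have "s (Suc n) = \<beta> * s n" using neq[of "Suc n"] step.hyps by (auto simp: sS min_def split: if_splits)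
      then show ?case using step by (simp add: Suc_diff_le)
    qed simp
    have \<beta>0: "\<beta> > 0" using c by simp
    define \<kappa> where "\<kappa> = s m / \<beta> ^ m"
    have "\<kappa> > 0" using s_pos \<beta>0 by (simp add: \<kappa>_def)
    from small[OF this] have "\<exists>n\<ge>m. real (f n) < \<kappa> * \<beta> ^ n" by (auto simp: frequently_sequentially)
    then obtain n where n: "n \<ge> m" "real (f n) < \<kappa> * \<beta> ^ n" by blast
    have "\<kappa> * \<beta> ^ n = s n" using sn[OF n(1)] \<beta>0 n(1) by (simp add: \<kappa>_def power_diff)
    with n s_le[of n] \<phi>_le[of n n] show False by simp
  qed
  have "\<exists>\<^sub>F n in sequentially. s n = real (f n)"
    unfolding frequently_sequentially
  proof
    fix m
    obtain n where n: "n \<ge> m" "s n = real (\<phi> n)" using touch by blast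
    \<comment> \<open>Contact with \<phi> at n becomes contact with \<open>f\<close> at the index k
      where the infimum is attained, since s n \<le> s k \<le> f k = s n.\<close>
    obtain k where k: "k \<ge> n" "\<phi> n = f k" using \<phi>_ex by blast
    have "s n \<le> s k" using s_mono k(1) by (simp add: monoD)
    then have "s k = real (f k)" using n(2) k(2) s_le[of k] \<phi>_le[of k k] by simp
    then show "\<exists>n\<ge>m. s n = real (f n)" using n(1) k(1) by (intro exI[of _ k]) simp
  qed
  moreover have "filterlim (\<lambda>n. s n / real n) at_top sequentially"
    by (rule filterlim_at_top_mono[OF filterlim_exponential_over_linear[OF c(1) C(1)]])
      (intro always_eventually allI divide_right_mono s_ge, simp)
  moreover have "s n \<le> real (f n)" for n using s_le[of n] \<phi>_le[of n n] by simp
  moreover have "s (Suc n) \<le> \<beta> * s n" for n by (simp add: sS)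
  ultimately show ?thesis using that s_mono s_pos by blast
qed

text \<open>Bounded growth of s means that s n / \<beta> ^ n is nonincreasing, so the least
  candidate above the running maximum is its quotient by \<open>\<beta> ^ n\<close> replaced by the
  supremum over later indices. Without contact that supremum would be a positive constant from some
  index on, but it tends to 0 because \<open>c < \<beta>\<close>.\<close>

lemma exists_upper_envelope:
  fixes f :: "nat \<Rightarrow> nat" and c C \<beta> :: real
  assumes c: "1 \<le> c" "c < \<beta>" and C: "\<And>n. real (f n) \<le> C * c ^ n"
    and f1: "\<And>n. f n \<ge> 1" and lin: "filterlim (\<lambda>n. real (f n) / real n) at_top sequentially"
  obtains s :: "nat \<Rightarrow> real" where "mono s" "filterlim (\<lambda>n. s n / real n) at_top sequentially"
    "\<And>n. s (Suc n) \<le> \<beta> * s n" "\<And>n. real (f n) \<le> s n"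
    "\<exists>\<^sub>F n in sequentially. s n = real (f n)"
proof -
  have \<beta>: "\<beta> > 1" using c by simp
  define \<Phi> where "\<Phi> n = Max (f ` {..n})" for n
  have \<Phi>_ge: "f k \<le> \<Phi> n" if "k \<le> n" for n k
    unfolding \<Phi>_def using that by (intro Max_ge) auto
  have \<Phi>_ex: "\<exists>k\<le>n. \<Phi> n = f k" for n
  proof -
    have "\<Phi> n \<in> f ` {..n}" unfolding \<Phi>_def by (rule Max_in) auto
    then show ?thesis by auto
  qed
  have \<Phi>_mono: "\<Phi> m \<le> \<Phi> n" if "m \<le> n" for m n
  proof -
    obtain k where "k \<le> m" "\<Phi> m = f k" using \<Phi>_ex by blast
    then show ?thesis using \<Phi>_ge[of k n] that by simp
  qed
  have C0: "C \<ge> 0" using C[of 0] by (rule_tac order_trans[of _ "real (f 0)"]) simp_all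
  have \<Phi>_le: "real (\<Phi> n) \<le> C * c ^ n" for n
  proof -
    obtain k where k: "k \<le> n" "\<Phi> n = f k" using \<Phi>_ex by blast
    have "c ^ k \<le> c ^ n" using k(1) c by (intro power_increasing) auto
    then have "C * c ^ k \<le> C * c ^ n" using C0 by (intro mult_left_mono) auto
    then show ?thesis using C[of k] k(2) by simp
  qed
  define g where "g k = real (\<Phi> k) / \<beta> ^ k" for k
  define G where "G n = Sup (g ` {n..})" for n
  define s where "s n = \<beta> ^ n * G n" for n
  have g_le: "g k \<le> C * (c / \<beta>) ^ k" for k
    using \<Phi>_le[of k] \<beta> by (simp add: g_def power_divide divide_right_mono)
  have g_le': "g k \<le> C * (c / \<beta>) ^ n" if "n \<le> k" for k n
  proof -
    have "(c / \<beta>) ^ k \<le> (c / \<beta>) ^ n" using that c by (intro power_decreasing) auto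
    then have "C * (c / \<beta>) ^ k \<le> C * (c / \<beta>) ^ n" using C0 by (intro mult_left_mono) auto
    then show ?thesis using g_le[of k] by simp
  qed
  have bdd: "bdd_above (g ` {n..})" for n
    by (rule bdd_aboveI[of _ "C * (c / \<beta>) ^ n"]) (use g_le' in auto)
  have G_le: "G n \<le> C * (c / \<beta>) ^ n" for n
    unfolding G_def by (rule cSup_least) (use g_le' in auto)
  have G_rec: "G n = max (g n) (G (Suc n))" for n
  proof -
    have "{n..} = insert n {Suc n..}" by auto
    then have "G n = Sup (insert (g n) (g ` {Suc n..}))" by (simp add: G_def)
    also have "\<dots> = sup (g n) (Sup (g ` {Suc n..}))" by (rule cSup_insert) (use bdd in auto)
    finally show ?thesis by (simp add: G_def sup_max)
  qed
  have s_ge: "real (\<Phi> n) \<le> s n" for n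
  proof -
    have "g n \<le> G n" using G_rec[of n] by simp
    then show ?thesis using \<beta> by (simp add: s_def g_def divide_le_eq mult.commute)
  qed
  have growth: "s (Suc n) \<le> \<beta> * s n" for n
  proof -
    have "G (Suc n) \<le> G n" using G_rec[of n] by simp
    then show ?thesis using \<beta> by (simp add: s_def)
  qed
  have s_mono: "mono s"
  proof (rule incseq_SucI)
    fix n
    have sS: "s (Suc n) \<ge> 0" using s_ge[of "Suc n"] by linarith
    \<comment> \<open>Backward recursion for the envelope; both arguments of the maximum are at most
      \<open>s (Suc n)\<close>.\<close>
    have "s n = max (real (\<Phi> n)) (s (Suc n) / \<beta>)"
    proof -
      have "s n = max (\<beta> ^ n * g n) (\<beta> ^ n * G (Suc n))"
        unfolding s_def using G_rec[of n] \<beta> by (auto simp: max_def)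
      then show ?thesis using \<beta> by (simp add: g_def s_def)
    qed
    moreover have "real (\<Phi> n) \<le> s (Suc n)"
      using s_ge[of "Suc n"] \<Phi>_mono[of n "Suc n"] by simp
    moreover have "s (Suc n) / \<beta> \<le> s (Suc n)"
    proof -
      have "s (Suc n) * 1 \<le> s (Suc n) * \<beta>" using sS \<beta> by (intro mult_left_mono) auto
      then show ?thesis using \<beta> by (simp add: divide_le_eq)
    qed
    ultimately show "s n \<le> s (Suc n)" by simp
  qed
  have \<Phi>1: "\<Phi> n \<ge> 1" for n using f1[of n] \<Phi>_ge[of n n] by simp
  have touch: "\<exists>n\<ge>m. s n = real (\<Phi> n)" for m
  proof (rule ccontr)
    assume "\<not> ?thesis"
    then have neq: "s n \<noteq> real (\<Phi> n)" if "n \<ge> m" for n using that by auto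
    have Gn: "G n = G m" if "n \<ge> m" for n
      using that
    proof (induction n rule: dec_induct)
      case (step n)
      have "G n \<noteq> g n" using neq[of n] step.hyps \<beta> by (auto simp: s_def g_def)
      then have "G (Suc n) = G n" using G_rec[of n] by (auto simp: max_def split: if_splits)
      then show ?case using step by simp
    qed simp
    have "0 < g m" using \<Phi>1[of m] \<beta> by (simp add: g_def)
    then have "0 < G m" using G_rec[of m] by simp
    have "(\<lambda>n. C * (c / \<beta>) ^ n) \<longlonglongrightarrow> 0"
      using c by (intro tendsto_mult_right_zero LIMSEQ_power_zero) simp
    then have "\<forall>\<^sub>F n in sequentially. C * (c / \<beta>) ^ n < G m"
      by (rule order_tendstoD(2)) fact
    then obtain k where k: "\<And>n. n \<ge> k \<Longrightarrow> C * (c / \<beta>) ^ n < G m"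
      unfolding eventually_sequentially by blast
    have "C * (c / \<beta>) ^ max k m < G m" "G (max k m) = G m" by (rule k, simp) (rule Gn, simp)
    with G_le[of "max k m"] show False by linarith
  qed
  have "\<exists>\<^sub>F n in sequentially. s n = real (f n)"
    unfolding frequently_sequentially
  proof
    fix m
    have "\<forall>\<^sub>F n in sequentially. real (f n) / real n \<ge> real (\<Phi> m) + 1"
      using lin by (simp add: filterlim_at_top)
    then obtain k0 where k0: "\<And>n. n \<ge> k0 \<Longrightarrow> real (f n) / real n \<ge> real (\<Phi> m) + 1"
      unfolding eventually_sequentially by blast
    \<comment> \<open>The maximum is attained at some j \<le> n, which could be too early. As
      \<open>f k1\<close> exceeds \<open>\<Phi> m\<close>, a contact at n \<ge> k1 has j >
      m.\<close>
    define k1 where "k1 = Suc k0"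
    have "(real (\<Phi> m) + 1) * 1 \<le> (real (\<Phi> m) + 1) * real k1"
      by (intro mult_left_mono) (auto simp: k1_def)
    also have "\<dots> \<le> real (f k1)" using k0[of k1] by (simp add: k1_def le_divide_eq)
    finally have big: "\<Phi> m < f k1" by simp
    obtain n where n: "n \<ge> k1" "s n = real (\<Phi> n)" using touch by blast
    obtain j where j: "j \<le> n" "\<Phi> n = f j" using \<Phi>_ex by blast
    have "j > m"
    proof (rule ccontr)
      assume "\<not> j > m"
      then have "f j \<le> \<Phi> m" by (intro \<Phi>_ge) simp
      with big \<Phi>_ge[of k1 n] n(1) j(2) show False by simp
    qed
    moreover have "s j \<le> s n" using s_mono j(1) by (simp add: monoD)
    then have "s j = real (f j)" using n(2) j(2) s_ge[of j] \<Phi>_ge[of j j] by simp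
    ultimately show "\<exists>n\<ge>m. s n = real (f n)" by (intro exI[of _ j]) simp
  qed
  moreover have fs: "real (f n) \<le> s n" for n using s_ge[of n] \<Phi>_ge[of n n] by simp
  moreover have "filterlim (\<lambda>n. s n / real n) at_top sequentially"
    by (rule filterlim_at_top_mono[OF lin])
      (intro always_eventually allI divide_right_mono fs, simp)
  ultimately show ?thesis using that s_mono growth by blast
qed

section \<open>From critical exponents to the two dimension formulas\<close>

section \<open>The dimension formulas\<close>

text \<open>Strict inequalities on both sides leave room to approach b, so only measures away from
  the critical exponent are needed. For infinite b the hypothesis \<open>low\<close> is vacuous and
  the dimension is 0 by \<open>up\<close> alone.\<close>

lemma hausdorff_dim_eqI:
  fixes A :: "'a::metric_space set" and b :: ennreal
  assumes b: "1 < b"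
    and up: "\<And>c t. 1 < c \<Longrightarrow> ennreal c < b \<Longrightarrow> t * (1 + c) > 1 \<Longrightarrow> hausdorff_measure t A = 0"
    and low: "\<And>\<beta> t. b < ennreal \<beta> \<Longrightarrow> 0 \<le> t \<Longrightarrow> t * (1 + \<beta>) < 1 \<Longrightarrow> hausdorff_measure t A \<noteq> 0"
  shows "hausdorff_dim A = 1 / (1 + b)"
proof (cases b rule: ennreal_cases)
  case (real r)
  have r: "r > 1" using b real by simp
  have dim: "1 / (1 + b) = ennreal (1 / (1 + r))"
    using real r by (simp add: divide_ennreal[symmetric] ennreal_plus)
  show ?thesis unfolding dim
  proof (rule antisym)
    show "hausdorff_dim A \<le> ennreal (1 / (1 + r))"
    proof (rule ennreal_le_epsilon)
      fix e :: real assume e: "e > 0"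
      define t where "t = 1 / (1 + r) + e"
      have t: "t > 0" "1 < t * (1 + r)" using e r by (simp_all add: t_def field_simps add_pos_pos)
      then have "1 / t - 1 < r" by (simp add: field_simps)
      then obtain c where c: "max 1 (1 / t - 1) < c" "c < r" using dense[of "max 1 (1 / t - 1)" r] r by auto
      have "hausdorff_measure t A = 0"
        using c t real by (intro up[of c]) (auto simp: ennreal_lessI field_simps)
      then have "hausdorff_dim A \<le> ennreal t"
        unfolding hausdorff_dim_def using t by (intro INF_lower) auto
      then show "hausdorff_dim A \<le> ennreal (1 / (1 + r)) + ennreal e"
        using e r by (simp add: t_def)
    qed
    show "ennreal (1 / (1 + r)) \<le> hausdorff_dim A"
      unfolding hausdorff_dim_def
    proof (rule INF_greatest)
      fix t assume "t \<in> {s. 0 \<le> s \<and> hausdorff_measure s A = 0}"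
      then have t: "0 \<le> t" "hausdorff_measure t A = 0" by auto
      show "ennreal (1 / (1 + r)) \<le> ennreal t"
      proof (rule ccontr)
        assume "\<not> ?thesis"
        then have "t < 1 / (1 + r)" using t by (simp add: ennreal_le_iff)
        then have tr: "t * (1 + r) < 1" using r by (simp add: field_simps)
        \<comment> \<open>The slack below 1; since t < 1, raising r by half of it keeps the product
          below 1.\<close>
        define \<delta> where "\<delta> = 1 - t * (1 + r)"
        have "t * 1 \<le> t * (1 + r)" using t(1) r by (intro mult_left_mono) auto
        then have "t < 1" using tr by simp
        then have "t * \<delta> \<le> 1 * \<delta>" using tr by (intro mult_right_mono) (auto simp: \<delta>_def)
        moreover have "\<delta> > 0" using tr by (simp add: \<delta>_def)
        moreover have "t * (1 + (r + \<delta> / 2)) = 1 - \<delta> + t * \<delta> / 2"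
          by (simp add: \<delta>_def algebra_simps)
        ultimately have "t * (1 + (r + \<delta> / 2)) < 1" by linarith
        then have "hausdorff_measure t A \<noteq> 0"
          using t(1) \<open>\<delta> > 0\<close> r real by (intro low[of "r + \<delta> / 2"]) (auto simp: ennreal_lessI)
        with t(2) show False by simp
      qed
    qed
  qed
next
  case top
  have "hausdorff_dim A \<le> 0"
  proof (rule ennreal_le_epsilon)
    fix e :: real assume e: "e > 0"
    \<comment> \<open>For c = 1 + 1/e the product e (1 + c) equals 1 + 2e.\<close>
    have "hausdorff_measure e A = 0"
      using e top by (intro up[of "1 + 1 / e"]) (auto simp: field_simps ennreal_less_top)
    then have "hausdorff_dim A \<le> ennreal e"
      unfolding hausdorff_dim_def using e by (intro INF_lower) auto
    then show "hausdorff_dim A \<le> 0 + ennreal e" by simp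
  qed
  then show ?thesis using top by simp
qed

lemma ln_less_ext_ln:
  assumes "1 < c" "ennreal c < b"
  shows "ereal (ln c) < ext_ln b"
proof (cases b rule: ennreal_cases)
  case (real r)
  then have "c < r" using assms by (simp add: ennreal_less_iff)
  then show ?thesis using assms(1) real by (simp add: ext_ln_def)
qed (simp add: ext_ln_def)

lemma ext_ln_less_ln:
  assumes "1 < b" "b < ennreal c"
  shows "ext_ln b < ereal (ln c)" "1 < c"
proof -
  obtain r where r: "b = ennreal r" "r \<ge> 0" using assms(2) by (cases b rule: ennreal_cases) auto
  have "1 < r" using assms(1) r by simp
  moreover have "r < c" using assms(2) r by (simp add: ennreal_less_iff)
  ultimately show "ext_ln b < ereal (ln c)" "1 < c" using r by (simp_all add: ext_ln_def)
qed

lemma power_le_of_ln_less: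
  fixes m :: nat
  assumes "ereal (ln c) < ereal (ln (real m) / real n)" "m \<ge> 1" "n \<ge> 1" "c > 0"
  shows "c ^ n \<le> real m"
proof -
  have "real n * ln c < ln (real m)" using assms(1,3) by (simp add: field_simps)
  then have "ln (c ^ n) < ln (real m)" using assms(4) by (simp add: ln_realpow)
  then show ?thesis using assms(2,4) by (subst (asm) ln_less_cancel_iff) auto
qed

lemma power_ge_of_ln_less:
  fixes m :: nat
  assumes "ereal (ln (real m) / real n) < ereal (ln c)" "m \<ge> 1" "n \<ge> 1" "c > 0"
  shows "real m \<le> c ^ n"
proof -
  have "ln (real m) < real n * ln c" using assms(1,3) by (simp add: field_simps)
  then have "ln (real m) < ln (c ^ n)" using assms(4) by (simp add: ln_realpow)
  then show ?thesis using assms(2,4) by (subst (asm) ln_less_cancel_iff) auto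
qed

text \<open>For a slightly smaller base c' the ratio of \<open>c ^ n / 2\<close> to
  \<open>c' ^ n\<close> is unbounded, while \<open>t * (1 + c') > 1\<close> still holds. The factor
  1/2 is a margin below the limit value 1 in both target sets.\<close>

lemma hausdorff_measure_fast_growth_subset:
  assumes c: "1 < c" and t: "t * (1 + c) > 1"
    and A: "A \<subseteq> {x \<in> {0..1}. x \<notin> \<rat> \<and> (\<exists>\<^sub>F n in sequentially. log_pq_sum n x \<ge> c ^ n / 2)}"
  shows "hausdorff_measure t A = 0"
proof -
  have t0: "t > 0" using c t by (smt (verit) zero_less_mult_pos2)
  have "1 / t - 1 < c" using t t0 by (simp add: field_simps)
  then obtain c' where c': "max 1 (1 / t - 1) < c'" "c' < c"
    using dense[of "max 1 (1 / t - 1)" c] c by auto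
  have "\<exists>n. log_pq_sum n x > K * c' ^ n" if x: "\<exists>\<^sub>F n in sequentially. log_pq_sum n x \<ge> c ^ n / 2" for x K
  proof -
    have "(\<lambda>n. 2 * K * (c' / c) ^ n) \<longlonglongrightarrow> 0"
      using c c' by (intro tendsto_mult_right_zero LIMSEQ_power_zero) simp
    then have "\<forall>\<^sub>F n in sequentially. 2 * K * (c' / c) ^ n < 1"
      by (rule order_tendstoD(2)) simp
    then obtain n where n: "2 * K * (c' / c) ^ n < 1" "log_pq_sum n x \<ge> c ^ n / 2"
      using frequently_eventually_frequently[OF x] frequently_ex by blast
    have "K * c' ^ n < c ^ n / 2" using n(1) c by (simp add: power_divide field_simps)
    then show ?thesis using n(2) by (intro exI[of _ n]) linarith
  qed
  then have "A \<subseteq> {x \<in> {0..1}. x \<notin> \<rat> \<and> (\<forall>K. \<exists>n. log_pq_sum n x > K * c' ^ n)}"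
    using A by blast
  then have "hausdorff_measure t A \<le> hausdorff_measure t \<dots>" by (rule hausdorff_measure_mono)
  also have "\<dots> = 0"
  proof (rule hausdorff_measure_fast_growth)
    show "t * (1 + c') > 1" using c' t0 by (simp add: field_simps)
  qed (use c' in simp)
  finally show ?thesis by simp
qed

theorem theorem1p2:
  fixes \<psi> :: "nat \<Rightarrow> nat" and b B :: ennreal
  assumes "\<And>n. n \<ge> 1 \<Longrightarrow> \<psi> n \<ge> 1"
    and "filterlim (\<lambda>n. real (\<psi> n) / real n) at_top sequentially"
    and "liminf (\<lambda>n. ereal (ln (real (\<psi> n)) / real n)) = ext_ln b"
    and "limsup (\<lambda>n. ereal (ln (real (\<psi> n)) / real n)) = ext_ln B"
    and "1 < b" and "1 < B"
  shows "hausdorff_dim (E_upper \<psi>) = 1 / (1 + b) \<and>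
         hausdorff_dim (E_lower \<psi>) = 1 / (1 + B)"
proof
  note pos = assms(1) and lin = assms(2) and lower = assms(3) and upper = assms(4)
  \<comment> \<open>Changes \<psi> at most at 0, about which nothing is assumed; the envelopes need
    bounds for all n.\<close>
  define f where "f n = max 1 (\<psi> n)" for n
  have f: "f n = \<psi> n" if "n \<ge> 1" for n using pos[OF that] by (simp add: f_def)
  have f1: "f n \<ge> 1" for n by (simp add: f_def)
  have ev1: "\<forall>\<^sub>F n in sequentially. n \<ge> (1::nat)" by (rule eventually_ge_at_top)
  have lin_f: "filterlim (\<lambda>n. real (f n) / real n) at_top sequentially"
    by (rule filterlim_at_top_mono[OF lin]) (rule always_eventually, simp add: f_def divide_right_mono)
  \<comment> \<open>Here and in the next three facts, liminf and limsup become comparisons of \<psi>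
    with powers. The formula for b uses the two about liminf, the formula for B the two about
    limsup.\<close>
  have low_ev: "\<forall>\<^sub>F n in sequentially. c ^ n \<le> real (\<psi> n)" if "1 < c" "ennreal c < b" for c
  proof -
    have "ereal (ln c) < liminf (\<lambda>n. ereal (ln (real (\<psi> n)) / real n))"
      unfolding lower by (rule ln_less_ext_ln[OF that])
    from less_LiminfD[OF this] ev1 show ?thesis
      by eventually_elim (rule power_le_of_ln_less, use pos that(1) in auto)
  qed
  have low_freq: "\<exists>\<^sub>F n in sequentially. real (\<psi> n) \<le> c ^ n" if "b < ennreal c" for c
  proof (rule ccontr)
    note c = ext_ln_less_ln[OF assms(5) that]
    assume "\<not> ?thesis"
    then have "\<forall>\<^sub>F n in sequentially. \<not> real (\<psi> n) \<le> c ^ n" by (simp add: not_frequently)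
    then have "\<forall>\<^sub>F n in sequentially. ereal (ln c) \<le> ereal (ln (real (\<psi> n)) / real n)"
      using ev1
    proof eventually_elim
      case (elim n)
      then show ?case using power_ge_of_ln_less[of "\<psi> n" n c] pos[of n] c(2) by (meson less_trans not_le zero_less_one)
    qed
    then have "ereal (ln c) \<le> liminf (\<lambda>n. ereal (ln (real (\<psi> n)) / real n))" by (rule Liminf_bounded)
    with c(1) show False unfolding lower by simp
  qed
  have up_freq: "\<exists>\<^sub>F n in sequentially. c ^ n \<le> real (\<psi> n)" if "1 < c" "ennreal c < B" for c
  proof (rule ccontr)
    assume "\<not> ?thesis"
    then have "\<forall>\<^sub>F n in sequentially. \<not> c ^ n \<le> real (\<psi> n)" by (simp add: not_frequently)
    then have "\<forall>\<^sub>F n in sequentially. ereal (ln (real (\<psi> n)) / real n) \<le> ereal (ln c)"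
      using ev1
    proof eventually_elim
      case (elim n)
      then show ?case using power_le_of_ln_less[of c "\<psi> n" n] pos[of n] that(1) by (meson less_trans not_le zero_less_one)
    qed
    then have "limsup (\<lambda>n. ereal (ln (real (\<psi> n)) / real n)) \<le> ereal (ln c)" by (rule Limsup_bounded)
    with ln_less_ext_ln[OF that] show False unfolding upper by simp
  qed
  have up_ev: "\<forall>\<^sub>F n in sequentially. real (\<psi> n) \<le> c ^ n" if "B < ennreal c" for c
  proof -
    note c = ext_ln_less_ln[OF assms(6) that]
    have "limsup (\<lambda>n. ereal (ln (real (\<psi> n)) / real n)) < ereal (ln c)"
      unfolding upper by (rule c(1))
    from Limsup_lessD[OF this] ev1 show ?thesis
      by eventually_elim (rule power_ge_of_ln_less, use pos c(2) in auto)
  qed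
  have ratio: "log_pq_sum n x \<ge> c ^ n / 2"
    if "ereal (1 / 2) \<le> ereal (log_pq_sum n x / real (\<psi> n))" "c ^ n \<le> real (\<psi> n)" "n \<ge> 1" for n x c
    using that pos[OF that(3)] by (simp add: field_simps)

  show "hausdorff_dim (E_upper \<psi>) = 1 / (1 + b)"
  proof (rule hausdorff_dim_eqI[OF assms(5)])
    fix c t :: real assume c: "1 < c" "ennreal c < b" and t: "t * (1 + c) > 1"
    show "hausdorff_measure t (E_upper \<psi>) = 0"
    proof (rule hausdorff_measure_fast_growth_subset[OF c(1) t], rule subsetI)
      fix x assume x: "x \<in> E_upper \<psi>"
      \<comment> \<open>A limsup equal to 1 gives half of \<psi> infinitely often, and \<psi>
        eventually exceeds \<open>c ^ n\<close>. For the liminf set the roles of "eventually" and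
        "infinitely often" are exchanged.\<close>
      have "\<exists>\<^sub>F n in sequentially. ereal (1 / 2) \<le> ereal (log_pq_sum n x / real (\<psi> n))"
      proof (rule ccontr)
        assume "\<not> ?thesis"
        then have "\<forall>\<^sub>F n in sequentially. ereal (log_pq_sum n x / real (\<psi> n)) \<le> ereal (1 / 2)"
          unfolding not_frequently by eventually_elim simp
        then have "limsup (\<lambda>n. ereal (log_pq_sum n x / real (\<psi> n))) \<le> ereal (1 / 2)"
          by (rule Limsup_bounded)
        with x show False by (simp add: E_upper_def one_ereal_def)
      qed
      then have "\<exists>\<^sub>F n in sequentially. log_pq_sum n x \<ge> c ^ n / 2"
        by (rule frequently_rev_mp) (use low_ev[OF c] ev1 in \<open>eventually_elim, blast intro: ratio\<close>)
      with x show "x \<in> {x \<in> {0..1}. x \<notin> \<rat> \<and> (\<exists>\<^sub>F n in sequentially. log_pq_sum n x \<ge> c ^ n / 2)}"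
        by (simp add: E_upper_def)
    qed
  next
    fix \<beta> t :: real assume \<beta>: "b < ennreal \<beta>" and t: "0 \<le> t" "t * (1 + \<beta>) < 1"
    obtain r where r: "b = ennreal r" "1 < r" "r < \<beta>"
      using assms(5) \<beta> by (cases b rule: ennreal_cases) (auto simp: ennreal_less_iff)
    obtain c where c: "1 < c" "c < r" using dense[OF r(2)] by blast
    \<comment> \<open>A base strictly between b and \<beta>: \<psi> is infinitely often at most
      \<open>\<beta>' ^ n\<close>, which is eventually below any positive multiple of
      \<open>\<beta> ^ n\<close>.\<close>
    obtain \<beta>' where \<beta>': "r < \<beta>'" "\<beta>' < \<beta>" using dense[OF r(3)] by blast
    have "\<forall>\<^sub>F n in sequentially. c ^ n \<le> real (\<psi> n)"
      using c r by (intro low_ev) (auto simp: ennreal_lessI)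
    then obtain m where m: "\<And>n. n \<ge> m \<Longrightarrow> c ^ n \<le> real (\<psi> n)"
      unfolding eventually_sequentially by blast
    \<comment> \<open>Division by \<open>c ^ m\<close> makes the bound at most 1 before m, where
      only \<open>f n \<ge> 1\<close> is known.\<close>
    have Cf: "1 / c ^ m * c ^ n \<le> real (f n)" for n
    proof (cases "n \<ge> m")
      case True
      have "1 / c ^ m * c ^ n \<le> 1 * c ^ n" using c by (intro mult_right_mono) auto
      then show ?thesis using m[OF True] by (simp add: f_def)
    next
      case False
      then have "c ^ n \<le> c ^ m" using c by (intro power_increasing) auto
      then have "1 / c ^ m * c ^ n \<le> 1" using c by simp
      then show ?thesis using f1[of n] by linarith
    qed
    have small: "\<exists>\<^sub>F n in sequentially. real (f n) < \<kappa> * \<beta> ^ n" if "\<kappa> > 0" for \<kappa>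
    proof -
      have "(\<lambda>n. (\<beta>' / \<beta>) ^ n) \<longlonglongrightarrow> 0" using \<beta>' r by (intro LIMSEQ_power_zero) simp
      then have "\<forall>\<^sub>F n in sequentially. (\<beta>' / \<beta>) ^ n < \<kappa>" by (rule order_tendstoD(2)) fact
      then have ev: "\<forall>\<^sub>F n in sequentially. real (\<psi> n) \<le> \<beta>' ^ n \<longrightarrow> real (f n) < \<kappa> * \<beta> ^ n"
        using ev1
      proof eventually_elim
        case (elim n)
        have "\<beta>' ^ n < \<kappa> * \<beta> ^ n" using elim(1) \<beta>' r by (simp add: power_divide field_simps)
        then show ?case using f[OF elim(2)] by simp
      qed
      have "\<exists>\<^sub>F n in sequentially. real (\<psi> n) \<le> \<beta>' ^ n"
        using \<beta>' r by (intro low_freq) (auto simp: ennreal_lessI)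
      then show ?thesis by (rule frequently_rev_mp) (rule ev)
    qed
    have "c \<le> \<beta>" "1 / c ^ m > 0" using c r by auto
    from exists_lower_envelope[OF c(1) this Cf small] obtain s where
      s: "mono s" "filterlim (\<lambda>n. s n / real n) at_top sequentially" "\<And>n. s (Suc n) \<le> \<beta> * s n"
        "\<And>n. s n > 0" "\<And>n. s n \<le> real (f n)" "\<exists>\<^sub>F n in sequentially. s n = real (f n)" by blast
    let ?K = "{x \<in> {0..1}. x \<notin> \<rat> \<and> (\<lambda>n. log_pq_sum n x / s n) \<longlonglongrightarrow> 1}"
    have "hausdorff_measure t ?K \<noteq> 0"
      using r by (intro hausdorff_measure_prescribed_growth[OF s(1,2,3) _ t]) simp
    moreover have "?K \<subseteq> E_upper \<psi>"
    proof
      fix x assume x: "x \<in> ?K"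
      have "limsup (\<lambda>n. ereal (log_pq_sum n x / real (\<psi> n))) = 1"
      proof (rule limsup_eqI_frequently)
        show "(\<lambda>n. ereal (log_pq_sum n x / s n)) \<longlonglongrightarrow> 1" using x by (simp add: one_ereal_def)
        show "\<forall>\<^sub>F n in sequentially. ereal (log_pq_sum n x / real (\<psi> n)) \<le> ereal (log_pq_sum n x / s n)"
          using ev1
        proof eventually_elim
          case (elim n)
          have "log_pq_sum n x / real (f n) \<le> log_pq_sum n x / s n"
            using s(4,5)[of n] f1[of n] log_pq_sum_nonneg[of x n] x
            by (intro divide_left_mono mult_pos_pos) auto
          then show ?case using f[OF elim] by simp
        qed
        show "\<exists>\<^sub>F n in sequentially. ereal (log_pq_sum n x / real (\<psi> n)) = ereal (log_pq_sum n x / s n)"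
          using s(6) by (rule frequently_rev_mp) (use ev1 in eventually_elim, use f in auto)
      qed
      then show "x \<in> E_upper \<psi>" using x by (simp add: E_upper_def)
    qed
    then have "hausdorff_measure t ?K \<le> hausdorff_measure t (E_upper \<psi>)" by (rule hausdorff_measure_mono)
    ultimately show "hausdorff_measure t (E_upper \<psi>) \<noteq> 0" by auto
  qed

  show "hausdorff_dim (E_lower \<psi>) = 1 / (1 + B)"
  proof (rule hausdorff_dim_eqI[OF assms(6)])
    fix c t :: real assume c: "1 < c" "ennreal c < B" and t: "t * (1 + c) > 1"
    show "hausdorff_measure t (E_lower \<psi>) = 0"
    proof (rule hausdorff_measure_fast_growth_subset[OF c(1) t], rule subsetI)
      fix x assume x: "x \<in> E_lower \<psi>"
      then have "ereal (1 / 2) < liminf (\<lambda>n. ereal (log_pq_sum n x / real (\<psi> n)))"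
        by (simp add: E_lower_def one_ereal_def)
      from less_LiminfD[OF this] ev1
      have ev: "\<forall>\<^sub>F n in sequentially. c ^ n \<le> real (\<psi> n) \<longrightarrow> log_pq_sum n x \<ge> c ^ n / 2"
        by eventually_elim (use ratio in \<open>blast intro: less_imp_le\<close>)
      have "\<exists>\<^sub>F n in sequentially. log_pq_sum n x \<ge> c ^ n / 2"
        by (rule frequently_rev_mp[OF up_freq[OF c] ev])
      with x show "x \<in> {x \<in> {0..1}. x \<notin> \<rat> \<and> (\<exists>\<^sub>F n in sequentially. log_pq_sum n x \<ge> c ^ n / 2)}"
        by (simp add: E_lower_def)
    qed
  next
    fix \<beta> t :: real assume \<beta>: "B < ennreal \<beta>" and t: "0 \<le> t" "t * (1 + \<beta>) < 1"
    obtain r where r: "B = ennreal r" "1 < r" "r < \<beta>"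
      using assms(6) \<beta> by (cases B rule: ennreal_cases) (auto simp: ennreal_less_iff)
    obtain c where c: "r < c" "c < \<beta>" using dense[OF r(3)] by blast
    have "\<forall>\<^sub>F n in sequentially. real (\<psi> n) \<le> c ^ n"
      using c r by (intro up_ev) (auto simp: ennreal_lessI)
    then obtain m where m: "\<And>n. n \<ge> m \<Longrightarrow> real (\<psi> n) \<le> c ^ n"
      unfolding eventually_sequentially by blast
    \<comment> \<open>Absorbs the finitely many values up to m, for which the exponential bound may
      fail.\<close>
    define C where "C = real (Max (f ` {..m}))"
    have C1: "C \<ge> 1"
    proof -
      have "f 0 \<le> Max (f ` {..m})" by (intro Max_ge) auto
      then show ?thesis using f1[of 0] unfolding C_def by linarith
    qed
    have cp: "c ^ n \<ge> 1" for n using c r by (intro one_le_power) simp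
    have Cf: "real (f n) \<le> C * c ^ n" for n
    proof (cases "n \<le> m")
      case True
      then have "real (f n) \<le> C" by (simp add: C_def)
      also have "C * 1 \<le> C * c ^ n" using C1 cp[of n] by (intro mult_left_mono) auto
      finally show ?thesis by simp
    next
      case False
      then have "real (f n) \<le> c ^ n" using m[of n] f[of n] by simp
      also have "1 * c ^ n \<le> C * c ^ n" using C1 cp[of n] by (intro mult_right_mono) auto
      finally show ?thesis by simp
    qed
    have "1 \<le> c" using c r by simp
    from exists_upper_envelope[OF this c(2) Cf f1 lin_f] obtain s where
      s: "mono s" "filterlim (\<lambda>n. s n / real n) at_top sequentially" "\<And>n. s (Suc n) \<le> \<beta> * s n"
        "\<And>n. real (f n) \<le> s n" "\<exists>\<^sub>F n in sequentially. s n = real (f n)" by blast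
    let ?K = "{x \<in> {0..1}. x \<notin> \<rat> \<and> (\<lambda>n. log_pq_sum n x / s n) \<longlonglongrightarrow> 1}"
    have "hausdorff_measure t ?K \<noteq> 0"
      using r by (intro hausdorff_measure_prescribed_growth[OF s(1,2,3) _ t]) simp
    moreover have "?K \<subseteq> E_lower \<psi>"
    proof
      fix x assume x: "x \<in> ?K"
      have "liminf (\<lambda>n. ereal (log_pq_sum n x / real (\<psi> n))) = 1"
      proof (rule liminf_eqI_frequently)
        show "(\<lambda>n. ereal (log_pq_sum n x / s n)) \<longlonglongrightarrow> 1" using x by (simp add: one_ereal_def)
        show "\<forall>\<^sub>F n in sequentially. ereal (log_pq_sum n x / s n) \<le> ereal (log_pq_sum n x / real (\<psi> n))"
          using ev1
        proof eventually_elim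
          case (elim n)
          have "real (f n) > 0" using f1[of n] by simp
          then have "log_pq_sum n x / s n \<le> log_pq_sum n x / real (f n)"
            using s(4)[of n] log_pq_sum_nonneg[of x n] x
            by (intro divide_left_mono mult_pos_pos) auto
          then show ?case using f[OF elim] by simp
        qed
        show "\<exists>\<^sub>F n in sequentially. ereal (log_pq_sum n x / real (\<psi> n)) = ereal (log_pq_sum n x / s n)"
          using s(5) by (rule frequently_rev_mp) (use ev1 in eventually_elim, use f in auto)
      qed
      then show "x \<in> E_lower \<psi>" using x by (simp add: E_lower_def)
    qed
    then have "hausdorff_measure t ?K \<le> hausdorff_measure t (E_lower \<psi>)" by (rule hausdorff_measure_mono)
    ultimately show "hausdorff_measure t (E_lower \<psi>) \<noteq> 0" by auto
  qed
qed

end
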